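(* Let $I,J\ge 1$, $K=R\ge 2$, $l\ge 0$ be integers, let $\mathbf A\in\mathbb R^{I\times R}$, $\mathbf B\in\mathbb R^{J\times R}$, $\mathbf C\in\mathbb R^{K\times R}$ with $r_{\mathbf C}=K=R$, and let $\mathcal T=[\mathbf A,\mathbf B,\mathbf C]_R\in\mathbb R^{I\times J\times K}$. Assume that $$\dim\left(\ker(\mathbf R_{2,l}(\mathcal T))\cap S^{2+l}(\mathbb R^{K^{2+l}})\right)=R .$$ Then (1) $r_{\mathcal T}=R$ and the CPD of $\mathcal T$ is unique; and (2) the CPD of $\mathcal T$ can be found algebraically.
   Context: All tensors and matrices are real; $r_{\mathbf X}$ is the rank of a matrix $\mathbf X$ and $\ker(\mathbf X)$ its null space. Decompositions. For $\mathbf A\in\mathbb R^{I\times R}$, $\mathbf B\in\mathbb R^{J\times R}$, $\mathbf C\in\mathbb R^{K\times R}$ with entries $a_{ir},b_{jr},c_{kr}$, write $\mathcal T=[\mathbf A,\mathbf B,\mathbf C]_R$ if $t_{ijk}=\sum_{r=1}^R a_{ir}b_{jr}c_{kr}$ for all $i,j,k$ (a polyadic decomposition, PD, with $R$ terms). The rank $r_{\mathcal T}$ is the minimal number of terms in a PD of $\mathcal T$; a PD with $r_{\mathcal T}$ terms is a canonical polyadic decomposition (CPD). The CPD of $\mathcal T$ is unique if any two CPDs $[\mathbf A,\mathbf B,\mathbf C]_R=[\bar{\mathbf A},\bar{\mathbf B},\bar{\mathbf C}]_R$ (with $R=r_{\mathcal T}$) consist of the same rank-one terms up to order, i.e. there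 are a permutation matrix $\mathbf P$ and nonsingular diagonal matrices $\mathbf\Lambda_1,\mathbf\Lambda_2,\mathbf\Lambda_3$ with $\mathbf\Lambda_1\mathbf\Lambda_2\mathbf\Lambda_3=\mathbf I_R$ and $\bar{\mathbf A}=\mathbf A\mathbf P\mathbf\Lambda_1$, $\bar{\mathbf B}=\mathbf B\mathbf P\mathbf\Lambda_2$, $\bar{\mathbf C}=\mathbf C\mathbf P\mathbf\Lambda_3$. The matrix $\mathbf R_{m,l}(\mathcal T)$ ($m\ge1$, $l\ge0$). It is the $I^{m+l}J^{m+l}\times K^{m+l}$ matrix whose $((\tilde i-1)J^{m+l}+\tilde j,\tilde k)$-th entry is $$\frac{1}{m!(m+l)!}\sum_{(s_1,\dots,s_{m+l})\in P_{\{k_1,\dots,k_{m+l}\}}}\det\left[t_{i_uj_vs_v}\right]_{u,v=1}^{m}\ \prod_{p=1}^{l}t_{i_{m+p}j_{m+p}s_{m+p}},$$ where $\tilde i=1+\sum_{p=1}^{m+l}(i_p-1)I^{m+l-p}$, $\tilde j=1+\sum_{p=1}^{m+l}(j_p-1)J^{m+l-p}$, $\tilde k=1+\sum_{p=1}^{m+l}(k_p-1)K^{m+l-p}$, with $i_p\in\{1,\dots,I\}$, $j_p\in\{1,\dots,J\}$, $k_p\in\{1,\dots,K\}$, and where $P_{\{k_1,\dots,k_n\}}$ is the family of all $n!$ permutations of $(k_1,\dots,k_n)$, counted with multiplicity when values coincide. $S^{n}(\mathbb R^{K^{n}})\subset\mathbb R^{K^n}$ is the span of all vectors $\mathbf x\otimes\cdots\otimes\mathbf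 x$ ($n$ factors, Kronecker product), $\mathbf x\in\mathbb R^K$ (vectorized symmetric $K\times\cdots\times K$ tensors of order $n$). "Found algebraically": there is a finite procedure, depending only on the dimensions, $R$ and $l$, which for every tensor $\mathcal T$ satisfying the hypotheses takes $\mathcal T$ as input and outputs factor matrices of a CPD of $\mathcal T$, and which uses only standard (exact) linear algebra: arithmetic and reshaping of arrays, finite enumeration and zero/rank tests, computation of null spaces, ranges, orthogonal complements and intersections of subspaces, solution of linear systems, and eigenvalue / singular value / generalized eigenvalue decompositions of matrices and matrix pencils. *)

theory Defs
  imports
    "Jordan_Normal_Form.DL_Rank"
    "Jordan_Normal_Form.Matrix_Kernel"
    "Jordan_Normal_Form.Determinant"
begin

section \<open>Subspaces of \<open>\<real>\<^sup>n\<close>\<close>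

abbreviation subsp :: "nat \<Rightarrow> real vec set \<Rightarrow> (real, real vec) module" where
  "subsp n W \<equiv> (module_vec TYPE(real) n)\<lparr>carrier := W\<rparr>"

abbreviation subsp_dim :: "nat \<Rightarrow> real vec set \<Rightarrow> nat" where
  "subsp_dim n W \<equiv> vectorspace.dim class_ring (subsp n W)"

abbreviation vspan :: "nat \<Rightarrow> real vec set \<Rightarrow> real vec set" where
  "vspan n S \<equiv> LinearCombinations.module.span class_ring (module_vec TYPE(real) n) S"

abbreviation mrank :: "real mat \<Rightarrow> nat" where
  "mrank A \<equiv> vec_space.rank (dim_row A) A"


section \<open>Polyadic decompositions\<close>

text \<open>
  All indices start at \<open>0\<close>. A tensor of format \<open>I \<times> J \<times> K\<close> is a function of which only the
  values at \<open>i < I\<close>, \<open>j < J\<close>, \<open>k < K\<close> are ever used; the format is always given explicitly.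
\<close>

type_synonym tensor = "nat \<Rightarrow> nat \<Rightarrow> nat \<Rightarrow> real"

definition is_pd ::
  "nat \<Rightarrow> nat \<Rightarrow> nat \<Rightarrow> nat \<Rightarrow> tensor \<Rightarrow> real mat \<Rightarrow> real mat \<Rightarrow> real mat \<Rightarrow> bool" where
  "is_pd I J K R T A B C \<longleftrightarrow>
     A \<in> carrier_mat I R \<and> B \<in> carrier_mat J R \<and> C \<in> carrier_mat K R \<and>
     (\<forall>i<I. \<forall>j<J. \<forall>k<K. T i j k = (\<Sum>r<R. A $$ (i, r) * B $$ (j, r) * C $$ (k, r)))"

definition tensor_rank :: "nat \<Rightarrow> nat \<Rightarrow> nat \<Rightarrow> tensor \<Rightarrow> nat" where
  "tensor_rank I J K T = (LEAST R. \<exists>A B C. is_pd I J K R T A B C)"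

definition is_cpd ::
  "nat \<Rightarrow> nat \<Rightarrow> nat \<Rightarrow> tensor \<Rightarrow> real mat \<Rightarrow> real mat \<Rightarrow> real mat \<Rightarrow> bool" where
  "is_cpd I J K T A B C \<longleftrightarrow> is_pd I J K (tensor_rank I J K T) T A B C"

definition permutation_mat :: "nat \<Rightarrow> real mat \<Rightarrow> bool" where
  "permutation_mat R P \<longleftrightarrow>
     (\<exists>\<pi>. \<pi> permutes {..<R} \<and> P = mat R R (\<lambda>(i, j). if i = \<pi> j then 1 else 0))"

definition nonsing_diag_mat :: "nat \<Rightarrow> real mat \<Rightarrow> bool" where
  "nonsing_diag_mat R L \<longleftrightarrow> L \<in> carrier_mat R R \<and> diagonal_mat L \<and> invertible_mat L"

definition cpd_unique :: "nat \<Rightarrow> nat \<Rightarrow> nat \<Rightarrow> tensor \<Rightarrow> bool" where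
  "cpd_unique I J K T \<longleftrightarrow>
     (\<forall>A B C A' B' C'. is_cpd I J K T A B C \<and> is_cpd I J K T A' B' C' \<longrightarrow>
        (let R = tensor_rank I J K T in
         \<exists>P L1 L2 L3. permutation_mat R P \<and>
           nonsing_diag_mat R L1 \<and> nonsing_diag_mat R L2 \<and> nonsing_diag_mat R L3 \<and>
           L1 * L2 * L3 = 1\<^sub>m R \<and>
           A' = A * P * L1 \<and> B' = B * P * L2 \<and> C' = C * P * L3))"


section \<open>The matrix \<open>R\<^bsub>m,l\<^esub>(T)\<close> and the space of symmetric tensors\<close>

text \<open>
  \<open>digit b n x p\<close> is the \<open>p\<close>-th of the \<open>n\<close> digits of \<open>x\<close> in base \<open>b\<close>, most significant digit
  first. So \<open>i\<^sub>0, \<dots>, i\<^bsub>n-1\<^esub>\<close> are the digits of \<open>\<Sum>p<n. i\<^sub>p * b ^ (n - 1 - p)\<close>.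
\<close>

definition digit :: "nat \<Rightarrow> nat \<Rightarrow> nat \<Rightarrow> nat \<Rightarrow> nat" where
  "digit b n x p = (x div b ^ (n - 1 - p)) mod b"

text \<open>
  The sum runs over the permutations \<open>\<sigma>\<close> of the positions, with \<open>s\<^sub>p = k\<^bsub>\<sigma>(p)\<^esub>\<close>; thus equal
  rearrangements of \<open>(k\<^sub>0, \<dots>, k\<^bsub>n-1\<^esub>)\<close> are counted with multiplicity.
\<close>

definition R_mat :: "nat \<Rightarrow> nat \<Rightarrow> nat \<Rightarrow> nat \<Rightarrow> nat \<Rightarrow> tensor \<Rightarrow> real mat" where
  "R_mat m l I J K T =
     mat (I ^ (m + l) * J ^ (m + l)) (K ^ (m + l)) (\<lambda>(row, col).
       let n = m + l;
           i = digit I n (row div J ^ n);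
           j = digit J n (row mod J ^ n);
           k = digit K n col
       in 1 / (fact m * fact (m + l)) *
          (\<Sum>\<sigma> | \<sigma> permutes {..<n}.
             det (mat m m (\<lambda>(u, v). T (i u) (j v) (k (\<sigma> v)))) *
             (\<Prod>p<l. T (i (m + p)) (j (m + p)) (k (\<sigma> (m + p))))))"

definition kron_vec :: "real vec \<Rightarrow> real vec \<Rightarrow> real vec" where
  "kron_vec x y = vec (dim_vec x * dim_vec y) (\<lambda>i. x $ (i div dim_vec y) * y $ (i mod dim_vec y))"

fun kron_pow :: "nat \<Rightarrow> real vec \<Rightarrow> real vec" where
  "kron_pow 0 x = vec 1 (\<lambda>_. 1)"
| "kron_pow (Suc n) x = kron_vec x (kron_pow n x)"

definition sym_space :: "nat \<Rightarrow> nat \<Rightarrow> real vec set" where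
  "sym_space n K = vspan (K ^ n) (kron_pow n ` carrier_vec K)"


section \<open>Algebraic procedures\<close>

text \<open>
  A procedure is a finite program over registers that hold real matrices. A program is written
  for fixed dimensions, so that loops over finite index sets, and finite enumeration in general,
  are unrolled into sequences and nested conditionals.
\<close>

datatype aexp =
    Const rat
  | Entry nat nat nat \<comment> \<open>register, row, column\<close>
  | Plus aexp aexp
  | Minus aexp aexp
  | Times aexp aexp
  | Divide aexp aexp

type_synonym state = "nat \<Rightarrow> real mat"

text \<open>
  Reading outside a matrix gives \<open>0\<close>, and so does division by zero. Neither adds power, as a
  program can guard an operation by rank and zero tests.
\<close>

fun aval :: "aexp \<Rightarrow> state \<Rightarrow> real" where
  "aval (Const c) s = of_rat c"
| "aval (Entry a i j) s = (if i < dim_row (s a) \<and> j < dim_col (s a) then s a $$ (i, j) else 0)"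
| "aval (Plus e f) s = aval e s + aval f s"
| "aval (Minus e f) s = aval e s - aval f s"
| "aval (Times e f) s = aval e s * aval f s"
| "aval (Divide e f) s = aval e s / aval f s"

text \<open>
  The arguments of an instruction are first its target registers and then its source registers.
  \<open>Arith\<close> builds a matrix of given size entry by entry, which covers matrix arithmetic as well as
  every reshaping, slicing and concatenation of arrays.
\<close>

datatype instr =
    Arith nat "aexp mat"
  | Null_Space nat nat
  | Range_Space nat nat
  | Orth_Compl nat nat
  | Intersection nat nat nat
  | Solve nat nat nat
  | Eigen nat nat nat
  | Gen_Eigen nat nat nat nat nat
  | Sing_Val nat nat nat nat

datatype prog =
    Instr instr
  | Seq prog prog
  | If_Zero aexp prog prog
  | If_Rank nat nat prog prog \<comment> \<open>does this register hold a matrix of this rank?\<close>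

definition basis_mat :: "nat \<Rightarrow> real vec set \<Rightarrow> real mat \<Rightarrow> bool" where
  "basis_mat n W N \<longleftrightarrow>
     dim_row N = n \<and> distinct (cols N) \<and> vectorspace.basis class_ring (subsp n W) (set (cols N))"

abbreviation col_sp :: "real mat \<Rightarrow> real vec set" where
  "col_sp A \<equiv> vec_space.col_space (dim_row A) A"

abbreviation orth_compl :: "nat \<Rightarrow> real vec set \<Rightarrow> real vec set" where
  "orth_compl n W \<equiv> vec_module.orthogonal_complement n W"

definition eigen_dec :: "real mat \<Rightarrow> real mat \<Rightarrow> real mat \<Rightarrow> bool" where
  "eigen_dec A V D \<longleftrightarrow>
     (\<exists>n. A \<in> carrier_mat n n \<and> V \<in> carrier_mat n n \<and> D \<in> carrier_mat n n \<and>
        invertible_mat V \<and> diagonal_mat D \<and> A * V = V * D)"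

text \<open>
  The generalized eigenvalues of the regular pencil \<open>(A, B)\<close> are the ratios of the diagonal
  entries of \<open>D\<close> and \<open>E\<close>, an entry \<open>0\<close> of \<open>E\<close> standing for the eigenvalue \<open>\<infinity>\<close>.
\<close>

definition gen_eigen_dec :: "real mat \<Rightarrow> real mat \<Rightarrow> real mat \<Rightarrow> real mat \<Rightarrow> real mat \<Rightarrow> bool" where
  "gen_eigen_dec A B V D E \<longleftrightarrow>
     (\<exists>n. A \<in> carrier_mat n n \<and> B \<in> carrier_mat n n \<and>
        V \<in> carrier_mat n n \<and> D \<in> carrier_mat n n \<and> E \<in> carrier_mat n n \<and>
        (\<exists>a b. det (a \<cdot>\<^sub>m A + b \<cdot>\<^sub>m B) \<noteq> 0) \<and>
        invertible_mat V \<and> diagonal_mat D \<and> diagonal_mat E \<and>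
        (\<forall>i<n. D $$ (i, i) \<noteq> 0 \<or> E $$ (i, i) \<noteq> 0) \<and> A * V * E = B * V * D)"

definition sing_val_dec :: "real mat \<Rightarrow> real mat \<Rightarrow> real mat \<Rightarrow> real mat \<Rightarrow> bool" where
  "sing_val_dec A U S V \<longleftrightarrow>
     (\<exists>m n. A \<in> carrier_mat m n \<and>
        U \<in> carrier_mat m m \<and> S \<in> carrier_mat m n \<and> V \<in> carrier_mat n n \<and>
        U\<^sup>T * U = 1\<^sub>m m \<and> V\<^sup>T * V = 1\<^sub>m n \<and> diagonal_mat S \<and>
        (\<forall>i<min m n. 0 \<le> S $$ (i, i)) \<and>
        (\<forall>i j. i \<le> j \<and> j < min m n \<longrightarrow> S $$ (j, j) \<le> S $$ (i, i)) \<and>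
        A = U * S * V\<^sup>T)"

text \<open>
  The possible successor states. Bases, solutions and decompositions are not unique, and an
  instruction may deliver any of them. There is no successor state, i.e.\ the instruction fails,
  if no admissible result exists: formats that do not match, an unsolvable linear system, or a
  matrix or pencil that cannot be diagonalized over the reals.
\<close>

fun step :: "instr \<Rightarrow> state \<Rightarrow> state set" where
  "step (Arith t M) s = {s(t := map_mat (\<lambda>e. aval e s) M)}"
| "step (Null_Space t a) s = {s(t := N) | N. basis_mat (dim_col (s a)) (mat_kernel (s a)) N}"
| "step (Range_Space t a) s = {s(t := N) | N. basis_mat (dim_row (s a)) (col_sp (s a)) N}"
| "step (Orth_Compl t a) s =
     {s(t := N) | N. basis_mat (dim_row (s a)) (orth_compl (dim_row (s a)) (col_sp (s a))) N}"
| "step (Intersection t a b) s =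
     {s(t := N) | N. dim_row (s a) = dim_row (s b) \<and>
        basis_mat (dim_row (s a)) (col_sp (s a) \<inter> col_sp (s b)) N}"
| "step (Solve t a b) s =
     {s(t := X) | X. X \<in> carrier_mat (dim_col (s a)) (dim_col (s b)) \<and>
        dim_row (s a) = dim_row (s b) \<and> s a * X = s b}"
| "step (Eigen t u a) s = {s(t := V, u := D) | V D. eigen_dec (s a) V D}"
| "step (Gen_Eigen t u v a b) s =
     {s(t := V, u := D, v := E) | V D E. gen_eigen_dec (s a) (s b) V D E}"
| "step (Sing_Val t u v a) s = {s(t := U, u := S, v := V) | U S V. sing_val_dec (s a) U S V}"

text \<open>
  \<open>guarantees p s Q\<close>: whatever admissible results the instructions deliver, the run of \<open>p\<close>
  from \<open>s\<close> never fails and it ends in a state satisfying \<open>Q\<close>.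
\<close>

fun guarantees :: "prog \<Rightarrow> state \<Rightarrow> (state \<Rightarrow> bool) \<Rightarrow> bool" where
  "guarantees (Instr c) s Q \<longleftrightarrow> step c s \<noteq> {} \<and> (\<forall>s'\<in>step c s. Q s')"
| "guarantees (Seq p q) s Q \<longleftrightarrow> guarantees p s (\<lambda>s'. guarantees q s' Q)"
| "guarantees (If_Zero e p q) s Q \<longleftrightarrow>
     (if aval e s = 0 then guarantees p s Q else guarantees q s Q)"
| "guarantees (If_Rank a r p q) s Q \<longleftrightarrow>
     (if mrank (s a) = r then guarantees p s Q else guarantees q s Q)"

text \<open>
  Initially register \<open>0\<close> holds the \<open>IJ \<times> K\<close> unfolding of the tensor and all other registers are
  empty. The factor matrices are returned in registers \<open>0\<close>, \<open>1\<close> and \<open>2\<close>.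
\<close>

definition input_state :: "nat \<Rightarrow> nat \<Rightarrow> nat \<Rightarrow> tensor \<Rightarrow> state" where
  "input_state I J K T =
     (\<lambda>_. 0\<^sub>m 0 0)(0 := mat (I * J) K (\<lambda>(row, k). T (row div J) (row mod J) k))"

definition cpd_found_algebraically :: "nat \<Rightarrow> nat \<Rightarrow> nat \<Rightarrow> tensor set \<Rightarrow> bool" where
  "cpd_found_algebraically I J K \<T> \<longleftrightarrow>
     (\<exists>p. \<forall>T\<in>\<T>. guarantees p (input_state I J K T) (\<lambda>s. is_cpd I J K T (s 0) (s 1) (s 2)))"

end

theory Submission
  imports Defs
begin

text \<open>
  Let \<open>n = 2 + l\<close>. Contracting the third mode of \<open>T\<close> with a vector \<open>x\<close> gives a matrix, the slice at \<open>x\<close>,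
  and applying \<open>R\<^bsub>2,l\<^esub>(T)\<close> to the Kronecker power \<open>x\<^sup>n = x \<otimes> \<dots> \<otimes> x\<close> gives, up to a constant factor, the
  products of a \<open>2 \<times> 2\<close> minor of the slice with \<open>l\<close> of its entries. Hence \<open>x\<^sup>n\<close> lies in the space \<open>W\<close> of
  symmetric kernel vectors as soon as the slice has rank at most one (\<open>rank_one_kron_pow_in_kernel\<close>).

  As \<open>C\<close> is nonsingular, its columns have a dual basis \<open>x\<^sub>1, \<dots>, x\<^sub>K\<close>. The slice at \<open>x\<^sub>r\<close> is the rank-one matrix
  formed by the columns \<open>r\<close> of \<open>A\<close> and \<open>B\<close>, so \<open>W\<close> contains the \<open>K\<close> linearly independent powers \<open>x\<^sub>r\<^sup>n\<close>, and the
  dimension hypothesis makes them a basis of \<open>W\<close> (\<open>kernel_basis_factor\<close>). A power \<open>x\<^sup>n\<close> in the span of the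
  \<open>x\<^sub>r\<^sup>n\<close> forces \<open>x\<close> to be a multiple of a single \<open>x\<^sub>r\<close>. So the slices of rank at most one occur exactly at the
  multiples of the \<open>x\<^sub>r\<close> (\<open>rank_one_imp_single_coord\<close>). This set depends on \<open>T\<close> only. Every decomposition with
  at most \<open>K\<close> terms has a nonsingular third factor, because a nonzero \<open>x\<close> orthogonal to its columns would give
  a zero slice; the dual basis of that factor again consists of points where the slice has rank one, so it is
  \<open>x\<^sub>1, \<dots>, x\<^sub>K\<close> up to order and scaling. Rank and uniqueness follow (\<open>tensor_rank_eq\<close>, \<open>pd_equivalent\<close>).

  For the algorithm, let the columns of \<open>N\<close> be any basis of \<open>W\<close>. Then \<open>N\<close> is the matrix with columns \<open>x\<^sub>r\<^sup>n\<close>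
  times an unknown nonsingular \<open>G\<close>. Contracting all factors but the first with a fixed weight vector turns \<open>N\<close>
  into \<open>X \<Delta> G\<close>, where \<open>X\<close> has the columns \<open>x\<^sub>r\<close> and \<open>\<Delta>\<close> is diagonal (\<open>moment_slice_factor\<close>). Two weight
  vectors give two such matrices. If the first is invertible, the quotient of the second by the first is
  \<open>G\<inverse> \<Delta>' G\<close> with another diagonal matrix \<open>\<Delta>'\<close>. If moreover the diagonal entries of \<open>\<Delta>'\<close> are distinct, an
  eigenvector matrix of this quotient is \<open>G\<inverse>\<close> up to order and scaling of its columns, which reveals multiples of the \<open>x\<^sub>r\<close>, hence \<open>C\<close> by inversion and \<open>A\<close>, \<open>B\<close> by factoring the rank-one
  slices. Suitable weight vectors are found on the moment curve: finitely many integer points of the curve,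
  their number bounded in terms of the dimensions, include one that avoids all the relevant hyperplanes
  (\<open>moment_curve_avoids\<close>). The program tries them in turn and verifies each outcome.
\<close>

section \<open>Digits and Kronecker powers\<close>

lemma sum_lessThan_mult:
  "(\<Sum>c<m * k. f c) = (\<Sum>v<m. \<Sum>c<k. f (v * k + c))" for k :: nat
proof -
  have "sum f {v * k..<v * k + k} = (\<Sum>c<k. f (v * k + c))" for v
    using sum.shift_bounds_nat_ivl[of f 0 "v * k" k]
    by (simp add: atLeast0LessThan add.commute)
  then show ?thesis
    by (simp flip: sum.nat_group)
qed

lemma mult_add_less: "v * k + c < m * k" if "v < m" "c < k" for k :: nat
proof -
  have "v * k + c < Suc v * k" using that by simp
  also have "\<dots> \<le> m * k" using that by (intro mult_le_mono1) simp
  finally show ?thesis .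
qed

lemma digit_less: "0 < b \<Longrightarrow> digit b n x p < b"
  by (simp add: digit_def)

lemma digit_Suc_0:
  assumes "v < b" "c < b ^ n"
  shows "digit b (Suc n) (v * b ^ n + c) 0 = v"
  using assms by (simp add: digit_def)

lemma digit_Suc_Suc:
  assumes "p < n" "0 < b"
  shows "digit b (Suc n) (v * b ^ n + c) (Suc p) = digit b n c p"
proof -
  have "b ^ n = b ^ (n - 1 - p) * (b * b ^ p)"
    using assms by (metis Suc_pred' le_add_diff_inverse2 less_eq_Suc_le mult.commute power_Suc power_add
      Suc_diff_Suc minus_nat.diff_0 diff_Suc_eq_diff_pred)
  then have eq: "v * b ^ n + c = c + (v * b ^ p * b) * b ^ (n - 1 - p)" by simp
  have nz: "b ^ (n - 1 - p) \<noteq> 0" using assms by simp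
  have "(v * b ^ n + c) div b ^ (n - 1 - p) = v * b ^ p * b + c div b ^ (n - 1 - p)"
    unfolding eq by (rule div_mult_self1[OF nz])
  then show ?thesis
    by (simp add: digit_def)
qed

text \<open>
  Expanding a product of sums: the digits of the numbers below \<open>b ^ n\<close> run through all \<open>n\<close>-tuples.
\<close>

lemma sum_prod_digit:
  fixes g :: "nat \<Rightarrow> nat \<Rightarrow> 'a :: comm_semiring_1"
  shows "(\<Sum>c<b ^ n. \<Prod>p<n. g p (digit b n c p)) = (\<Prod>p<n. \<Sum>v<b. g p v)"
proof (induction n arbitrary: g)
  case 0
  then show ?case by simp
next
  case (Suc n)
  have "(\<Sum>c<b ^ Suc n. \<Prod>p<Suc n. g p (digit b (Suc n) c p)) =
      (\<Sum>v<b. \<Sum>c<b ^ n. \<Prod>p<Suc n. g p (digit b (Suc n) (v * b ^ n + c) p))"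
    by (simp only: power_Suc sum_lessThan_mult)
  also have "\<dots> = (\<Sum>v<b. \<Sum>c<b ^ n. g 0 v * (\<Prod>p<n. g (Suc p) (digit b n c p)))"
    by (intro sum.cong refl) (simp only: prod.lessThan_Suc_shift, auto simp: digit_Suc_0 digit_Suc_Suc)
  also have "\<dots> = (\<Sum>v<b. g 0 v) * (\<Prod>p<n. \<Sum>v<b. g (Suc p) v)"
    by (simp add: Suc.IH[of "\<lambda>p. g (Suc p)"] sum_distrib_left[symmetric] sum_distrib_right)
  also have "\<dots> = (\<Prod>p<Suc n. \<Sum>v<b. g p v)"
    by (simp only: prod.lessThan_Suc_shift)
  finally show ?case .
qed

lemma sum_prod_digit_permuted:
  fixes g :: "nat \<Rightarrow> nat \<Rightarrow> 'a :: comm_semiring_1"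
  assumes s: "s permutes {..<n}"
  shows "(\<Sum>c<b ^ n. \<Prod>p<n. g p (digit b n c (s p))) = (\<Prod>p<n. \<Sum>v<b. g p v)"
proof -
  note inv = permutes_inv[OF s]
  have "(\<Prod>p<n. g p (digit b n c (s p))) = (\<Prod>p<n. g (inv_into UNIV s p) (digit b n c p))" for c
    by (subst prod.permute[OF inv]) (simp add: o_def permutes_inverses[OF s])
  then show ?thesis
    by (simp add: sum_prod_digit[of "\<lambda>p. g (inv_into UNIV s p)"] prod.permute[OF inv, of "\<lambda>p. \<Sum>v<b. g p v"] o_def)
qed

lemma kron_pow_carrier: "x \<in> carrier_vec K \<Longrightarrow> kron_pow n x \<in> carrier_vec (K ^ n)"
  by (induction n) (auto simp: kron_vec_def)

lemma index_kron_pow_Suc: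
  assumes "x \<in> carrier_vec K" "v < K" "c < K ^ n"
  shows "kron_pow (Suc n) x $ (v * K ^ n + c) = x $ v * kron_pow n x $ c"
  using assms kron_pow_carrier[OF assms(1), of n] mult_add_less[of v K c "K ^ n"]
  by (simp add: kron_vec_def)

lemma index_kron_pow:
  assumes x: "x \<in> carrier_vec K" and c: "c < K ^ n"
  shows "kron_pow n x $ c = (\<Prod>p<n. x $ digit K n c p)"
  using c
proof (induction n arbitrary: c)
  case 0
  then show ?case by simp
next
  case (Suc n)
  have K: "0 < K ^ n" "0 < K" using Suc.prems by (auto intro: Nat.gr0I)
  define v d where "v = c div K ^ n" and "d = c mod K ^ n"
  have cd: "c = v * K ^ n + d"
    unfolding v_def d_def by (rule div_mult_mod_eq[symmetric])
  have vd: "v < K" "d < K ^ n"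
    using Suc.prems K by (simp_all add: v_def d_def less_mult_imp_div_less)
  show ?case
    unfolding cd index_kron_pow_Suc[OF x vd] prod.lessThan_Suc_shift
    using vd K by (simp add: Suc.IH digit_Suc_0 digit_Suc_Suc)
qed

text \<open>
  A Kronecker power is a symmetric tensor, so it does not matter in which order its factors are contracted.
  This is why all the permutations in \<open>R_mat\<close> contribute equally on Kronecker powers.
\<close>

lemma sum_prod_digit_kron_pow:
  assumes s: "s permutes {..<n}" and x: "x \<in> carrier_vec K"
  shows "(\<Sum>c<K ^ n. (\<Prod>p<n. g p (digit K n c (s p))) * kron_pow n x $ c)
    = (\<Prod>p<n. \<Sum>v<K. g p v * x $ v)"
proof -
  have "kron_pow n x $ c = (\<Prod>p<n. x $ digit K n c (s p))" if "c < K ^ n" for c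
    unfolding index_kron_pow[OF x that]
    by (subst prod.permute[OF s]) (simp add: o_def)
  then have "(\<Sum>c<K ^ n. (\<Prod>p<n. g p (digit K n c (s p))) * kron_pow n x $ c)
    = (\<Sum>c<K ^ n. \<Prod>p<n. g p (digit K n c (s p)) * x $ digit K n c (s p))"
    by (simp add: prod.distrib)
  also have "\<dots> = (\<Prod>p<n. \<Sum>v<K. g p v * x $ v)"
    by (rule sum_prod_digit_permuted[OF s, of "\<lambda>p v. g p v * x $ v"])
  finally show ?thesis .
qed

lemma kron_pow_prod_contract:
  assumes x: "x \<in> carrier_vec K"
  shows "(\<Sum>c<K ^ n. (\<Prod>p<n. y p (digit K n c p)) * kron_pow n x $ c) = (\<Prod>p<n. \<Sum>v<K. y p v * x $ v)"
  using sum_prod_digit_kron_pow[OF permutes_id x, where g = y and n = n] by simp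

section \<open>Symmetric tensors\<close>

text \<open>
  Ryser's formula for the permanent. Expanding the products on the right gives a sum over all maps \<open>g\<close> from
  positions to positions, and the signed sum over the sets \<open>S\<close> that contain the image of \<open>g\<close> vanishes unless
  \<open>g\<close> is a permutation. It is needed for polarization: it writes the symmetrization of a product of unit
  vectors as a combination of Kronecker powers.
\<close>

lemma ryser_permanent:
  fixes a :: "nat \<Rightarrow> nat \<Rightarrow> 'a :: comm_ring_1"
  shows "(\<Sum>s | s permutes {..<n}. \<Prod>p<n. a (s p) p)
    = (\<Sum>S\<in>Pow {..<n}. (- 1) ^ (n - card S) * (\<Prod>p<n. \<Sum>q\<in>S. a q p))"
proof -
  let ?N = "{..<n}" and ?F = "{..<n} \<rightarrow>\<^sub>E {..<n}"
  have alt: "(\<Sum>S | S \<subseteq> ?N \<and> g ` ?N \<subseteq> S. (- 1) ^ (n - card S)) = (if g ` ?N = ?N then 1 else 0 :: 'a)"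
    if g: "g \<in> ?F" for g
  proof -
    let ?Q = "?N - g ` ?N"
    have gN: "g ` ?N \<subseteq> ?N" using g by auto
    have "(\<Sum>S | S \<subseteq> ?N \<and> g ` ?N \<subseteq> S. (- 1) ^ (n - card S)) = (\<Sum>X\<in>Pow ?Q. (- 1 :: 'a) ^ card X)"
    proof (rule sum.reindex_bij_witness[of _ "\<lambda>X. ?N - X" "\<lambda>S. ?N - S"])
      fix S assume "S \<in> {S. S \<subseteq> ?N \<and> g ` ?N \<subseteq> S}"
      then show "(- 1 :: 'a) ^ card (?N - S) = (- 1) ^ (n - card S)"
        by (subst card_Diff_subset) (auto intro: finite_subset)
    qed (use gN in auto)
    also have "\<dots> = (\<Prod>x\<in>?Q. - 1 + 1)"
      by (subst prod_add) auto
    also have "\<dots> = (if g ` ?N = ?N then 1 else 0)"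
      using gN by (cases "?Q = {}") (auto simp: power_0_left card_gt_0_iff)
    finally show ?thesis .
  qed
  have "(\<Sum>S\<in>Pow ?N. (- 1) ^ (n - card S) * (\<Prod>p<n. \<Sum>q\<in>S. a q p))
     = (\<Sum>S\<in>Pow ?N. \<Sum>g\<in>?F. if g ` ?N \<subseteq> S then (- 1) ^ (n - card S) * (\<Prod>p<n. a (g p) p) else 0)"
  proof (rule sum.cong[OF refl])
    fix S assume S: "S \<in> Pow ?N"
    then have fin: "finite S" by (auto intro: finite_subset)
    have eq: "?N \<rightarrow>\<^sub>E S = {g \<in> ?F. g ` ?N \<subseteq> S}"
      using S by (auto simp: PiE_iff extensional_def image_subset_iff)
    have "(\<Prod>p<n. \<Sum>q\<in>S. a q p) = (\<Sum>g\<in>?N \<rightarrow>\<^sub>E S. \<Prod>p<n. a (g p) p)"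
      by (rule prod_sum_PiE) (auto simp: fin)
    then show "(- 1) ^ (n - card S) * (\<Prod>p<n. \<Sum>q\<in>S. a q p)
      = (\<Sum>g\<in>?F. if g ` ?N \<subseteq> S then (- 1) ^ (n - card S) * (\<Prod>p<n. a (g p) p) else 0)"
      unfolding eq by (simp add: sum_distrib_left sum.inter_filter[symmetric] finite_PiE)
  qed
  also have "\<dots> = (\<Sum>g\<in>?F. (\<Sum>S | S \<subseteq> ?N \<and> g ` ?N \<subseteq> S. (- 1) ^ (n - card S)) * (\<Prod>p<n. a (g p) p))"
    by (subst sum.swap)
      (simp add: sum.inter_filter[symmetric] sum_distrib_right Pow_def Collect_conj_eq[symmetric])
  also have "\<dots> = (\<Sum>g\<in>?F. if g ` ?N = ?N then (\<Prod>p<n. a (g p) p) else 0)"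
    by (intro sum.cong refl) (simp only: alt, simp)
  also have "\<dots> = (\<Sum>g\<in>{g \<in> ?F. g ` ?N = ?N}. \<Prod>p<n. a (g p) p)"
    by (simp add: sum.inter_filter[symmetric] finite_PiE)
  also have "\<dots> = (\<Sum>s | s permutes ?N. \<Prod>p<n. a (s p) p)"
  proof (rule sum.reindex_bij_witness[of _ "\<lambda>s. restrict s ?N" "\<lambda>g x. if x \<in> ?N then g x else x"])
    fix g assume "g \<in> {g \<in> ?F. g ` ?N = ?N}"
    then have g: "g \<in> ?F" "g ` ?N = ?N" by auto
    then have "bij_betw g ?N ?N"
      by (auto simp: bij_betw_def intro: eq_card_imp_inj_on)
    then have "bij_betw (\<lambda>x. if x \<in> ?N then g x else x) ?N ?N"
      by (subst bij_betw_cong[of _ _ g]) auto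
    then show "(\<lambda>x. if x \<in> ?N then g x else x) \<in> {s. s permutes ?N}"
      by (intro CollectI bij_imp_permutes) auto
    show "restrict (\<lambda>x. if x \<in> ?N then g x else x) ?N = g"
      using g(1) by (auto simp: fun_eq_iff PiE_iff extensional_def)
  next
    fix s assume "s \<in> {s. s permutes ?N}"
    then have s: "s permutes ?N" by simp
    show "(\<lambda>x. if x \<in> ?N then restrict s ?N x else x) = s"
      using s by (auto simp: fun_eq_iff permutes_not_in)
    show "restrict s ?N \<in> {g \<in> ?F. g ` ?N = ?N}"
      using permutes_image[OF s] by (auto simp: image_restrict_eq)
  qed auto
  finally show ?thesis by simp
qed

text \<open>
  As a matrix indexed by \<open>i\<close> and \<open>c\<close>, this is \<open>n!\<close> times the projection onto the symmetric tensors. Its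
  integral entries make it available to a program with rational constants.
\<close>

definition sym_count :: "nat \<Rightarrow> nat \<Rightarrow> nat \<Rightarrow> nat \<Rightarrow> nat" where
  "sym_count n K i c = card {s. s permutes {..<n} \<and> (\<forall>p<n. digit K n i p = digit K n c (s p))}"

lemma of_nat_sym_count:
  "of_nat (sym_count n K i c) =
    (\<Sum>s | s permutes {..<n}. \<Prod>p<n. of_bool (digit K n i p = digit K n c (s p)) :: 'a :: comm_semiring_1)"
proof -
  have all: "(\<Prod>p<m. of_bool (P p)) = (of_bool (\<forall>p<m. P p) :: 'a)" for m :: nat and P
    by (induction m) (auto simp: less_Suc_eq)
  show ?thesis
    unfolding all sym_count_def
    by (simp add: finite_permutations sum.inter_filter[symmetric] of_bool_def Collect_conj_eq[symmetric]
       flip: sum.inter_filter)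
qed

lemma sym_count_kron_pow:
  assumes x: "x \<in> carrier_vec K" and i: "i < K ^ n"
  shows "(\<Sum>c<K ^ n. of_nat (sym_count n K i c) * kron_pow n x $ c) = fact n * kron_pow n x $ i"
proof (cases "K = 0")
  case True
  with i show ?thesis by (cases n) (simp_all add: sym_count_def)
next
  case False
  have "(\<Sum>c<K ^ n. of_nat (sym_count n K i c) * kron_pow n x $ c)
     = (\<Sum>s | s permutes {..<n}. \<Sum>c<K ^ n.
          (\<Prod>p<n. of_bool (digit K n i p = digit K n c (s p))) * kron_pow n x $ c)"
    by (simp add: of_nat_sym_count sum_distrib_right sum.swap[of _ "{..<K ^ n}"])
  also have "\<dots> = (\<Sum>s | s permutes {..<n}. \<Prod>p<n. \<Sum>v<K. of_bool (digit K n i p = v) * x $ v)"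
    by (rule sum.cong[OF refl])
      (simp add: sum_prod_digit_kron_pow[OF _ x, where g = "\<lambda>p v. of_bool (digit K n i p = v)"])
  also have "\<dots> = fact n * kron_pow n x $ i"
    using False by (simp add: index_kron_pow[OF x i] of_bool_def if_distrib[of "\<lambda>t. t * _"] digit_less
        card_permutations cong: if_cong)
  finally show ?thesis .
qed

lemma vspan_index:
  assumes S: "S \<subseteq> carrier_vec n" and f: "f \<in> vspan n S"
  obtains A a where "finite A" "A \<subseteq> S" "\<And>i. i < n \<Longrightarrow> f $ i = (\<Sum>v\<in>A. a v * v $ i)"
proof -
  interpret vec_space "TYPE(real)" n .
  obtain a A where "f = lincomb a A" "finite A" "A \<subseteq> S"
    using in_spanE[OF f] by blast
  then show ?thesis
    using S by (intro that[of A a]) (auto simp: lincomb_index)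
qed

lemma vspan_sumI:
  assumes S: "S \<subseteq> carrier_vec n" and v: "\<And>s. s \<in> F \<Longrightarrow> v s \<in> vspan n S" and F: "finite F"
  shows "vec n (\<lambda>i. \<Sum>s\<in>F. a s * v s $ i) \<in> vspan n S"
  using F v
proof (induction F)
  interpret vec_space "TYPE(real)" n .
  case empty
  have "vec n (\<lambda>i. \<Sum>s\<in>{}. a s * v s $ i) = 0\<^sub>v n" by auto
  then show ?case using in_spanI[of _ "\<lambda>_. 0" "{}" S] by (simp add: lincomb_def)
next
  interpret vec_space "TYPE(real)" n .
  case (insert s F)
  have vs: "v s \<in> vspan n S" using insert.prems by simp
  then have car: "v s \<in> carrier_vec n" using span_closed[OF S] by auto
  have "vec n (\<lambda>i. \<Sum>s\<in>insert s F. a s * v s $ i) = a s \<cdot>\<^sub>v v s + vec n (\<lambda>i. \<Sum>s\<in>F. a s * v s $ i)"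
    using insert.hyps car by auto
  also have "\<dots> \<in> vspan n S"
    using insert by (intro span_add1[OF S] smult_in_span[OF S]) auto
  finally show ?case .
qed

lemma kron_pow_subset: "kron_pow n ` carrier_vec K \<subseteq> carrier_vec (K ^ n)"
  using kron_pow_carrier by blast

lemma kron_pow_in_sym_space: "x \<in> carrier_vec K \<Longrightarrow> kron_pow n x \<in> sym_space n K"
proof -
  interpret vec_space "TYPE(real)" "K ^ n" .
  show "x \<in> carrier_vec K \<Longrightarrow> kron_pow n x \<in> sym_space n K"
    unfolding sym_space_def using in_own_span[OF kron_pow_subset] by blast
qed

text \<open>
  The span of the Kronecker powers is the space fixed by symmetrization: Kronecker powers are fixed, and
  conversely a fixed tensor is a combination of symmetrized unit vectors, which lie in the span by
  polarization.
\<close>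

lemma sym_space_iff:
  assumes K: "0 < K"
  shows "f \<in> sym_space n K \<longleftrightarrow> f \<in> carrier_vec (K ^ n) \<and>
    (\<forall>i<K ^ n. (\<Sum>c<K ^ n. of_nat (sym_count n K i c) * f $ c) = fact n * f $ i)"
proof (intro iffI conjI allI impI; (elim conjE)?)
  interpret vec_space "TYPE(real)" "K ^ n" .
  assume f: "f \<in> sym_space n K"
  then show "f \<in> carrier_vec (K ^ n)"
    unfolding sym_space_def using span_closed[OF kron_pow_subset] by auto
  fix i assume i: "i < K ^ n"
  obtain A a where A: "finite A" "A \<subseteq> kron_pow n ` carrier_vec K"
    and fA: "\<And>i. i < K ^ n \<Longrightarrow> f $ i = (\<Sum>v\<in>A. a v * v $ i)"
    using vspan_index[OF kron_pow_subset f[unfolded sym_space_def]] by blast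
  have "(\<Sum>c<K ^ n. of_nat (sym_count n K i c) * f $ c)
     = (\<Sum>v\<in>A. a v * (\<Sum>c<K ^ n. of_nat (sym_count n K i c) * v $ c))"
    by (simp add: fA sum_distrib_left sum.swap[of _ A] mult.left_commute)
  also have "\<dots> = (\<Sum>v\<in>A. a v * (fact n * v $ i))"
    using A(2) sym_count_kron_pow[OF _ i] by (intro sum.cong refl) auto
  also have "\<dots> = fact n * f $ i"
    by (simp add: fA[OF i] sum_distrib_left mult.left_commute)
  finally show "(\<Sum>c<K ^ n. of_nat (sym_count n K i c) * f $ c) = fact n * f $ i" .
next
  assume car: "f \<in> carrier_vec (K ^ n)"
    and f: "\<forall>i<K ^ n. (\<Sum>c<K ^ n. of_nat (sym_count n K i c) * f $ c) = fact n * f $ i"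
  define orbit where "orbit c = vec (K ^ n) (\<lambda>i. of_nat (sym_count n K i c) :: real)" for c
  have orbit: "orbit c \<in> sym_space n K" if "c < K ^ n" for c
  proof -
    \<comment> \<open>\<open>y S\<close> is the sum of the unit vectors selected by the digits of \<open>c\<close> at the positions in \<open>S\<close>.\<close>
    define y where "y S = vec K (\<lambda>v. \<Sum>q\<in>S. of_bool (v = digit K n c q) :: real)" for S
    have y: "y S \<in> carrier_vec K" for S by (simp add: y_def)
    have "orbit c = vec (K ^ n) (\<lambda>i. \<Sum>S\<in>Pow {..<n}. (- 1) ^ (n - card S) * kron_pow n (y S) $ i)"
      unfolding orbit_def of_nat_sym_count
      by (intro eq_vecI; simp add: index_kron_pow[OF y]
          ryser_permanent[of "\<lambda>q p. of_bool (digit K n _ p = digit K n c q)"])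
        (simp add: y_def digit_less[OF K])
    also have "\<dots> \<in> sym_space n K"
      unfolding sym_space_def using kron_pow_in_sym_space[OF y]
      by (intro vspan_sumI kron_pow_subset) (auto simp: sym_space_def)
    finally show ?thesis .
  qed
  have "f = vec (K ^ n) (\<lambda>i. \<Sum>c<K ^ n. (f $ c / fact n) * orbit c $ i)"
  proof (rule eq_vecI)
    fix i assume "i < dim_vec (vec (K ^ n) (\<lambda>i. \<Sum>c<K ^ n. (f $ c / fact n) * orbit c $ i))"
    then have i: "i < K ^ n" by simp
    have "f $ i = (fact n * f $ i) / fact n" by simp
    also have "\<dots> = (\<Sum>c<K ^ n. of_nat (sym_count n K i c) * f $ c) / fact n"
      using f i by simp
    also have "\<dots> = (\<Sum>c<K ^ n. (f $ c / fact n) * orbit c $ i)"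
      by (simp add: orbit_def i sum_divide_distrib mult.commute)
    finally show "f $ i = vec (K ^ n) (\<lambda>i. \<Sum>c<K ^ n. (f $ c / fact n) * orbit c $ i) $ i"
      using i by simp
  qed (use car in simp)
  also have "\<dots> \<in> sym_space n K"
    unfolding sym_space_def using orbit
    by (intro vspan_sumI kron_pow_subset) (auto simp: sym_space_def)
  finally show "f \<in> sym_space n K" .
qed

section \<open>Kronecker powers in the kernel of the matrix R\<close>

lemma R_mat_carrier: "R_mat m l I J K T \<in> carrier_mat (I ^ (m + l) * J ^ (m + l)) (K ^ (m + l))"
  by (simp add: R_mat_def)

lemma det_2:
  assumes "A \<in> carrier_mat 2 2"
  shows "det A = A $$ (0, 0) * A $$ (1, 1) - A $$ (0, 1) * A $$ (1, 0)"
  using assms laplace_expansion_column[OF assms, of 0]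
  by (simp add: cofactor_def mat_delete_def det_single numeral_2_eq_2 algebra_simps)

text \<open>
  Each of the \<open>n\<close> third-mode indices of a summand of \<open>R_mat\<close> is contracted with \<open>x\<close>, which replaces the entries
  of \<open>T\<close> by entries of the slice \<open>M\<close> at \<open>x\<close>. All permutations give the same value, and their number cancels
  against the normalization.
\<close>

lemma R_mat_mult_kron_pow:
  assumes x: "x \<in> carrier_vec K" and r: "r < I ^ (2 + l) * J ^ (2 + l)"
    and i: "i = digit I (2 + l) (r div J ^ (2 + l))" and j: "j = digit J (2 + l) (r mod J ^ (2 + l))"
    and M: "\<And>i j. M i j = (\<Sum>k<K. T i j k * x $ k)"
  shows "(R_mat 2 l I J K T *\<^sub>v kron_pow (2 + l) x) $ r =
    1 / 2 * (M (i 0) (j 0) * M (i 1) (j 1) - M (i 0) (j 1) * M (i 1) (j 0)) * (\<Prod>p<l. M (i (2 + p)) (j (2 + p)))"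
proof -
  define n where "n = 2 + l"
  note r = r[folded n_def] and i = i[folded n_def] and j = j[folded n_def]
  let ?k = "digit K n" and ?R = "R_mat 2 l I J K T"
  \<comment> \<open>The two terms of the determinant, as products over all positions.\<close>
  define g h where "g p v = T (i p) (j p) v"
    and "h p v = (if p = 0 then T (i 1) (j 0) v else if p = 1 then T (i 0) (j 1) v else g p v)" for p v
  have split: "(\<Prod>p<n. F p) = F 0 * F 1 * (\<Prod>p<l. F (2 + p))" for F :: "nat \<Rightarrow> real"
    by (simp add: n_def numeral_2_eq_2 prod.lessThan_Suc_shift del: prod.lessThan_Suc)
  have contr: "(\<Sum>c<K ^ n. (\<Prod>p<n. F p (?k c (s p))) * kron_pow n x $ c) = (\<Prod>p<n. \<Sum>v<K. F p v * x $ v)"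
    if "s permutes {..<n}" for s and F :: "nat \<Rightarrow> nat \<Rightarrow> real"
    by (rule sum_prod_digit_kron_pow[OF that x])
  have R: "?R $$ (r, c) = 1 / (2 * fact n) * (\<Sum>s | s permutes {..<n}.
      (\<Prod>p<n. g p (?k c (s p))) - (\<Prod>p<n. h p (?k c (s p))))" if "c < K ^ n" for c
    using that r unfolding split R_mat_def Let_def n_def[symmetric]
    by (simp add: det_2 fact_2 i j g_def h_def algebra_simps)
  have "(?R *\<^sub>v kron_pow n x) $ r = (\<Sum>c<K ^ n. ?R $$ (r, c) * kron_pow n x $ c)"
    using R_mat_carrier[of 2 l I J K T, folded n_def] kron_pow_carrier[OF x, of n] r
    by (simp add: scalar_prod_def atLeast0LessThan)
  also have "\<dots> = (\<Sum>c<K ^ n. 1 / (2 * fact n) * (\<Sum>s | s permutes {..<n}.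
      (\<Prod>p<n. g p (?k c (s p))) * kron_pow n x $ c - (\<Prod>p<n. h p (?k c (s p))) * kron_pow n x $ c))"
    by (intro sum.cong refl) (simp add: R sum_distrib_right left_diff_distrib)
  also have "\<dots> = 1 / (2 * fact n) * (\<Sum>s | s permutes {..<n}.
      (\<Prod>p<n. \<Sum>v<K. g p v * x $ v) - (\<Prod>p<n. \<Sum>v<K. h p v * x $ v))"
    unfolding sum_distrib_left[symmetric]
    by (subst sum.swap, intro arg_cong[where f = "(*) _"] sum.cong refl)
      (simp only: mem_Collect_eq sum_subtractf contr[where F = g] contr[where F = h])
  also have "\<dots> = 1 / 2 * ((\<Prod>p<n. \<Sum>v<K. g p v * x $ v) - (\<Prod>p<n. \<Sum>v<K. h p v * x $ v))"
    by (simp add: card_permutations)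
  also have "(\<Prod>p<n. \<Sum>v<K. g p v * x $ v) = M (i 0) (j 0) * M (i 1) (j 1) * (\<Prod>p<l. M (i (2 + p)) (j (2 + p)))"
    by (simp add: split g_def M)
  also have "(\<Prod>p<n. \<Sum>v<K. h p v * x $ v) = M (i 0) (j 1) * M (i 1) (j 0) * (\<Prod>p<l. M (i (2 + p)) (j (2 + p)))"
    by (simp add: split h_def g_def M)
  finally show ?thesis by (simp add: n_def algebra_simps)
qed

lemma R_mat_cong:
  assumes "0 < I" "0 < J" "0 < K"
    and "\<And>i j k. i < I \<Longrightarrow> j < J \<Longrightarrow> k < K \<Longrightarrow> T i j k = T' i j k"
  shows "R_mat m l I J K T = R_mat m l I J K T'"
  unfolding R_mat_def Let_def using assms by (intro cong_mat refl) (simp add: digit_less)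

lemma rank_one_kron_pow_in_kernel:
  assumes I: "0 < I" and J: "0 < J" and x: "x \<in> carrier_vec K"
    and ab: "\<And>i j. i < I \<Longrightarrow> j < J \<Longrightarrow> (\<Sum>k<K. T i j k * x $ k) = a i * b j"
  shows "kron_pow (2 + l) x \<in> mat_kernel (R_mat 2 l I J K T) \<inter> sym_space (2 + l) K"
proof -
  let ?R = "R_mat 2 l I J K T"
  have "?R *\<^sub>v kron_pow (2 + l) x = 0\<^sub>v (dim_row ?R)"
  proof (rule eq_vecI)
    fix r assume "r < dim_vec (0\<^sub>v (dim_row ?R))"
    then have r: "r < I ^ (2 + l) * J ^ (2 + l)" by (simp add: R_mat_def)
    show "(?R *\<^sub>v kron_pow (2 + l) x) $ r = 0\<^sub>v (dim_row ?R) $ r"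
      unfolding R_mat_mult_kron_pow[OF x r refl refl refl]
      using r by (simp add: ab digit_less I J R_mat_def)
  qed simp
  moreover have "kron_pow (2 + l) x \<in> carrier_vec (dim_col ?R)"
    using kron_pow_carrier[OF x, of "2 + l"] by (simp add: R_mat_def del: kron_pow.simps)
  ultimately show ?thesis
    unfolding mat_kernel_def using kron_pow_in_sym_space[OF x] by blast
qed

text \<open>
  The condition of being fixed by symmetrization is appended to \<open>R_mat\<close> as further rows, so that one null
  space computation delivers the symmetric kernel vectors.
\<close>

definition sym_kernel_mat :: "nat \<Rightarrow> nat \<Rightarrow> nat \<Rightarrow> nat \<Rightarrow> tensor \<Rightarrow> real mat" where
  "sym_kernel_mat l I J K T = (let n = 2 + l; m = I ^ n * J ^ n in
     mat (m + K ^ n) (K ^ n) (\<lambda>(r, c). if r < m then R_mat 2 l I J K T $$ (r, c)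
       else of_nat (sym_count n K (r - m) c) - (if r - m = c then fact n else 0)))"

lemma sym_kernel_mat_carrier:
  "sym_kernel_mat l I J K T \<in> carrier_mat (I ^ (2 + l) * J ^ (2 + l) + K ^ (2 + l)) (K ^ (2 + l))"
  by (simp add: sym_kernel_mat_def Let_def)

lemma mat_kernel_sum_iff:
  assumes "A \<in> carrier_mat m n"
  shows "v \<in> mat_kernel A \<longleftrightarrow> v \<in> carrier_vec n \<and> (\<forall>r<m. (\<Sum>c<n. A $$ (r, c) * v $ c) = 0)"
  using assms
  by (auto simp: mat_kernel_def scalar_prod_def atLeast0LessThan vec_eq_iff)

lemma mat_kernel_sym_kernel_mat:
  assumes K: "0 < K"
  shows "mat_kernel (sym_kernel_mat l I J K T) = mat_kernel (R_mat 2 l I J K T) \<inter> sym_space (2 + l) K"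
proof (rule Set.set_eqI)
  fix v
  define n where "n = 2 + l"
  define m where "m = I ^ n * J ^ n"
  note R = mat_kernel_sum_iff[OF R_mat_carrier[of 2 l I J K T, folded n_def m_def]]
  let ?S = "sym_kernel_mat l I J K T"
  have split: "(\<forall>r<m + k. P r) \<longleftrightarrow> (\<forall>r<m. P r) \<and> (\<forall>i<k. P (m + i))" for k P
  proof (intro iffI conjI allI impI; (elim conjE)?)
    fix r assume "\<forall>r<m. P r" "\<forall>i<k. P (m + i)" "r < m + k"
    then show "P r" by (cases "r < m") (auto simp: not_less nat_le_iff_add)
  qed auto
  have "v \<in> mat_kernel ?S \<longleftrightarrow> v \<in> carrier_vec (K ^ n) \<and>
      (\<forall>r<m. (\<Sum>c<K ^ n. ?S $$ (r, c) * v $ c) = 0) \<and>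
      (\<forall>i<K ^ n. (\<Sum>c<K ^ n. ?S $$ (m + i, c) * v $ c) = 0)"
    unfolding mat_kernel_sum_iff[OF sym_kernel_mat_carrier[of l I J K T, folded n_def m_def]]
    unfolding split ..
  also have "(\<forall>r<m. (\<Sum>c<K ^ n. ?S $$ (r, c) * v $ c) = 0)
      \<longleftrightarrow> (\<forall>r<m. (\<Sum>c<K ^ n. R_mat 2 l I J K T $$ (r, c) * v $ c) = 0)"
    unfolding sym_kernel_mat_def Let_def n_def[symmetric] m_def[symmetric] by simp
  also have "(\<forall>i<K ^ n. (\<Sum>c<K ^ n. ?S $$ (m + i, c) * v $ c) = 0)
      \<longleftrightarrow> (\<forall>i<K ^ n. (\<Sum>c<K ^ n. of_nat (sym_count n K i c) * v $ c) = fact n * v $ i)"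
    unfolding sym_kernel_mat_def Let_def n_def[symmetric] m_def[symmetric]
    by (simp add: left_diff_distrib
        sum_subtractf if_distrib[of "\<lambda>t. t * _"] cong: if_cong)
  finally show "v \<in> mat_kernel ?S \<longleftrightarrow> v \<in> mat_kernel (R_mat 2 l I J K T) \<inter> sym_space (2 + l) K"
    unfolding Int_iff R sym_space_iff[OF K] n_def[symmetric] by blast
qed

section \<open>Bases of kernels as matrices\<close>

lemma basis_mat_kernel_exists:
  assumes A: "A \<in> carrier_mat m n"
  shows "\<exists>N. basis_mat n (mat_kernel A) N"
proof -
  interpret kernel m n A by unfold_locales (rule A)
  obtain S where S: "finite S" "basis S"
    using kernel_basis_exists[OF A] by blast
  then have sub: "S \<subseteq> carrier_vec n"
    using mat_kernel_carrier[OF A] unfolding Ker.basis_def by blast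
  obtain xs where xs: "set xs = S" "distinct xs"
    using finite_distinct_list[OF S(1)] by blast
  then have "cols (mat_of_cols n xs) = xs"
    using sub by (intro cols_mat_of_cols) auto
  then show ?thesis
    using S(2) xs by (intro exI[of _ "mat_of_cols n xs"]) (simp add: basis_mat_def)
qed

lemma basis_mat_kernel:
  assumes A: "A \<in> carrier_mat m n" and N: "basis_mat n (mat_kernel A) N"
  shows "N \<in> carrier_mat n (subsp_dim n (mat_kernel A))"
    and "v \<in> mat_kernel A \<Longrightarrow> \<exists>y \<in> carrier_vec (subsp_dim n (mat_kernel A)). v = N *\<^sub>v y"
proof -
  interpret kernel m n A by unfold_locales (rule A)
  from N have dim_row: "dim_row N = n" and dist: "distinct (cols N)" and bas: "basis (set (cols N))"
    by (auto simp: basis_mat_def)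
  have "subsp_dim n (mat_kernel A) = card (set (cols N))"
    by (rule Ker.dim_basis[OF _ bas]) simp
  also have "\<dots> = dim_col N"
    using distinct_card[OF dist] by simp
  finally have dim: "subsp_dim n (mat_kernel A) = dim_col N" .
  then show N': "N \<in> carrier_mat n (subsp_dim n (mat_kernel A))"
    using dim_row by auto
  assume v: "v \<in> mat_kernel A"
  from bas have sub: "set (cols N) \<subseteq> mat_kernel A" and sp: "span (set (cols N)) = mat_kernel A"
    unfolding Ker.basis_def by auto
  have "v \<in> NC.span (set (cols N))"
    using v sp span_same[OF sub] by simp
  then obtain a where "v = NC.lincomb a (set (cols N))"
    using NC.finite_in_span[of "set (cols N)" v] sub mat_kernel_carrier[OF A] by auto
  also have "\<dots> = N *\<^sub>v vec (dim_col N) (\<lambda>i. a (col N i))"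
    using NC.mat_mult_eq_lincomb[OF _ dist] dim_row by (metis carrier_matI)
  finally show "\<exists>y \<in> carrier_vec (subsp_dim n (mat_kernel A)). v = N *\<^sub>v y"
    unfolding dim by (metis vec_carrier)
qed

lemma dual_basis:
  fixes C :: "'a :: field mat"
  assumes C: "C \<in> carrier_mat n n" and det: "det C \<noteq> 0"
  obtains X where "X \<in> carrier_mat n n"
    "\<And>r q. r < n \<Longrightarrow> q < n \<Longrightarrow> (\<Sum>v<n. C $$ (v, r) * X $$ (v, q)) = of_bool (r = q)"
    "\<And>w v. w < n \<Longrightarrow> v < n \<Longrightarrow> (\<Sum>s<n. X $$ (w, s) * C $$ (v, s)) = of_bool (w = v)"
proof -
  have Ct: "C\<^sup>T \<in> carrier_mat n n" "det (C\<^sup>T) \<noteq> 0"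
    using C det by (auto simp: det_transpose)
  obtain X where X: "X \<in> carrier_mat n n" "X * C\<^sup>T = 1\<^sub>m n" "C\<^sup>T * X = 1\<^sub>m n"
    using det_non_zero_imp_unit[OF Ct, of undefined] by (auto simp: Units_def ring_mat_def)
  show ?thesis
  proof (rule that[OF X(1)])
    show "(\<Sum>v<n. C $$ (v, r) * X $$ (v, q)) = of_bool (r = q)" if "r < n" "q < n" for r q
      using that C X(1) arg_cong[OF X(3), of "\<lambda>M. M $$ (r, q)"]
      by (simp add: scalar_prod_def atLeast0LessThan)
    show "(\<Sum>s<n. X $$ (w, s) * C $$ (v, s)) = of_bool (w = v)" if "w < n" "v < n" for w v
      using that C X(1) arg_cong[OF X(2), of "\<lambda>M. M $$ (w, v)"]
      by (simp add: scalar_prod_def atLeast0LessThan)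
  qed
qed

section \<open>Slices of rank one\<close>

text \<open>
  The hypotheses on one decomposition. Nonsingularity of \<open>C\<close> is the form in which full rank is used.
\<close>

locale cpd_kernel =
  fixes I J K l :: nat and T :: tensor and A B C :: "real mat"
  assumes I: "0 < I" and J: "0 < J" and K: "2 \<le> K"
    and pd: "is_pd I J K K T A B C" and det_C: "det C \<noteq> 0"
    and dim_kernel: "subsp_dim (K ^ (2 + l)) (mat_kernel (R_mat 2 l I J K T) \<inter> sym_space (2 + l) K) = K"
begin

lemma carrier: "A \<in> carrier_mat I K" "B \<in> carrier_mat J K" "C \<in> carrier_mat K K"
  using pd by (auto simp: is_pd_def)

definition slice :: "real vec \<Rightarrow> nat \<Rightarrow> nat \<Rightarrow> real" where
  "slice x i j = (\<Sum>k<K. T i j k * x $ k)"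

definition coord :: "real vec \<Rightarrow> nat \<Rightarrow> real" where
  "coord x r = (\<Sum>v<K. C $$ (v, r) * x $ v)"

lemma slice_of_pd:
  assumes "is_pd I J K R T A' B' C'" "i < I" "j < J"
  shows "slice x i j = (\<Sum>r<R. A' $$ (i, r) * B' $$ (j, r) * (\<Sum>v<K. C' $$ (v, r) * x $ v))"
proof -
  have "slice x i j = (\<Sum>k<K. \<Sum>r<R. A' $$ (i, r) * B' $$ (j, r) * (C' $$ (k, r) * x $ k))"
    using assms by (simp add: slice_def is_pd_def sum_distrib_left sum_distrib_right mult_ac)
  then show ?thesis
    by (subst (asm) sum.swap) (simp add: sum_distrib_left)
qed

lemma slice_eq: "i < I \<Longrightarrow> j < J \<Longrightarrow> slice x i j = (\<Sum>r<K. A $$ (i, r) * B $$ (j, r) * coord x r)"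
  by (simp add: slice_of_pd[OF pd] coord_def)

text \<open>
  The columns of \<open>X\<close> are the basis dual to the columns of \<open>C\<close>, and \<open>coord x\<close> lists the coordinates of \<open>x\<close> in
  this basis.
\<close>

definition X :: "real mat" where
  "X = (SOME X. X \<in> carrier_mat K K \<and>
    (\<forall>r<K. \<forall>q<K. (\<Sum>v<K. C $$ (v, r) * X $$ (v, q)) = of_bool (r = q)) \<and>
    (\<forall>w<K. \<forall>v<K. (\<Sum>s<K. X $$ (w, s) * C $$ (v, s)) = of_bool (w = v)))"

lemma
  shows X_carrier: "X \<in> carrier_mat K K"
    and C_X: "r < K \<Longrightarrow> q < K \<Longrightarrow> (\<Sum>v<K. C $$ (v, r) * X $$ (v, q)) = of_bool (r = q)"
    and X_C: "w < K \<Longrightarrow> v < K \<Longrightarrow> (\<Sum>s<K. X $$ (w, s) * C $$ (v, s)) = of_bool (w = v)"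
proof -
  let ?P = "\<lambda>X. X \<in> carrier_mat K K \<and>
    (\<forall>r<K. \<forall>q<K. (\<Sum>v<K. C $$ (v, r) * X $$ (v, q)) = of_bool (r = q)) \<and>
    (\<forall>w<K. \<forall>v<K. (\<Sum>s<K. X $$ (w, s) * C $$ (v, s)) = of_bool (w = v))"
  have "\<exists>X. ?P X"
    by (rule dual_basis[OF carrier(3) det_C]) blast
  then have "?P X"
    unfolding X_def by (rule someI_ex)
  then show "X \<in> carrier_mat K K"
    "r < K \<Longrightarrow> q < K \<Longrightarrow> (\<Sum>v<K. C $$ (v, r) * X $$ (v, q)) = of_bool (r = q)"
    "w < K \<Longrightarrow> v < K \<Longrightarrow> (\<Sum>s<K. X $$ (w, s) * C $$ (v, s)) = of_bool (w = v)"
    by blast+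
qed

lemma vec_eq_coord:
  assumes x: "x \<in> carrier_vec K" and w: "w < K"
  shows "x $ w = (\<Sum>r<K. X $$ (w, r) * coord x r)"
proof -
  have "(\<Sum>r<K. X $$ (w, r) * coord x r) = (\<Sum>r<K. \<Sum>v<K. X $$ (w, r) * C $$ (v, r) * x $ v)"
    by (simp add: coord_def sum_distrib_left mult_ac)
  also have "\<dots> = (\<Sum>v<K. (\<Sum>r<K. X $$ (w, r) * C $$ (v, r)) * x $ v)"
    by (subst sum.swap) (simp add: sum_distrib_right)
  also have "\<dots> = x $ w"
    using w by (simp add: X_C of_bool_def if_distrib[of "\<lambda>t. t * _"] cong: if_cong)
  finally show ?thesis by simp
qed

lemma coord_eq_0_imp:
  assumes "x \<in> carrier_vec K" "\<And>r. r < K \<Longrightarrow> coord x r = 0"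
  shows "x = 0\<^sub>v K"
proof (rule eq_vecI)
  fix w assume "w < dim_vec (0\<^sub>v K :: real vec)"
  then have "w < K" by simp
  then show "x $ w = 0\<^sub>v K $ w"
    using vec_eq_coord[OF assms(1), of w] assms(2) by simp
qed (use assms(1) in simp)

lemma coord_X:
  assumes "r < K"
  shows "coord (vec K (\<lambda>v. \<Sum>q<K. X $$ (v, q) * \<xi> q)) r = \<xi> r"
proof -
  have "coord (vec K (\<lambda>v. \<Sum>q<K. X $$ (v, q) * \<xi> q)) r = (\<Sum>v<K. \<Sum>q<K. C $$ (v, r) * X $$ (v, q) * \<xi> q)"
    by (simp add: coord_def sum_distrib_left mult_ac)
  also have "\<dots> = (\<Sum>q<K. (\<Sum>v<K. C $$ (v, r) * X $$ (v, q)) * \<xi> q)"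
    by (subst sum.swap) (simp add: sum_distrib_right)
  also have "\<dots> = \<xi> r"
    using assms by (simp add: C_X of_bool_def if_distrib[of "\<lambda>t. t * _"] cong: if_cong)
  finally show ?thesis .
qed

definition X_pow :: "nat \<Rightarrow> real mat" where
  "X_pow n = mat (K ^ n) K (\<lambda>(c, r). kron_pow n (col X r) $ c)"

lemma X_pow_carrier: "X_pow n \<in> carrier_mat (K ^ n) K"
  by (simp add: X_pow_def)

lemma col_X_carrier: "col X r \<in> carrier_vec K"
  using X_carrier by (intro carrier_vecI) (simp only: dim_col carrier_matD)

lemma coord_col_X: "r < K \<Longrightarrow> q < K \<Longrightarrow> coord (col X q) r = of_bool (r = q)"
  using C_X[of r q] X_carrier by (simp add: coord_def)

lemma slice_single_coord:
  assumes "\<And>r. r < K \<Longrightarrow> r \<noteq> q \<Longrightarrow> coord x r = 0" "q < K" "i < I" "j < J"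
  shows "slice x i j = coord x q * (A $$ (i, q) * B $$ (j, q))"
proof -
  have "slice x i j = (\<Sum>r<K. if r = q then coord x q * (A $$ (i, q) * B $$ (j, q)) else 0)"
    unfolding slice_eq[OF assms(3,4)] using assms(1) by (intro sum.cong refl) auto
  then show ?thesis using assms by simp
qed

lemma X_pow_contract:
  assumes "q < K"
  shows "(\<Sum>c<K ^ n. (\<Prod>p<n. y p (digit K n c p)) * X_pow n $$ (c, q)) = (\<Prod>p<n. \<Sum>v<K. y p v * X $$ (v, q))"
  using kron_pow_prod_contract[OF col_X_carrier, where n = n and y = y and r1 = q] X_carrier assms
  by (simp add: X_pow_def)

abbreviation sym_mat :: "real mat" where
  "sym_mat \<equiv> sym_kernel_mat l I J K T"

lemma kernel_sym_mat: "mat_kernel sym_mat = mat_kernel (R_mat 2 l I J K T) \<inter> sym_space (2 + l) K"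
  using K by (intro mat_kernel_sym_kernel_mat) simp

text \<open>
  The powers of the dual basis vectors lie in the kernel, so they are \<open>N * F\<close> for a square matrix \<open>F\<close>; it is
  square because the kernel has dimension \<open>K\<close>. The powers of the columns of \<open>C\<close> are dual to them, which makes
  \<open>F\<close> invertible.
\<close>

lemma kernel_basis_factor:
  assumes n_def: "n = 2 + l" and N: "basis_mat (K ^ n) (mat_kernel sym_mat) N"
  obtains F G where "F \<in> carrier_mat K K" "G \<in> carrier_mat K K"
    "F * G = 1\<^sub>m K" "G * F = 1\<^sub>m K" "N = X_pow n * G"
proof -
  have n: "0 < n" by (simp add: n_def)
  note bas = basis_mat_kernel[OF sym_kernel_mat_carrier N[unfolded n_def], unfolded kernel_sym_mat dim_kernel, folded n_def]
  have "\<exists>y. y \<in> carrier_vec K \<and> kron_pow n (col X r) = N *\<^sub>v y" if "r < K" for r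
  proof -
    have "slice (col X r) i j = A $$ (i, r) * B $$ (j, r)" if "i < I" "j < J" for i j
      using that \<open>r < K\<close> by (subst slice_single_coord[where q = r]) (simp_all add: coord_col_X)
    then have "kron_pow n (col X r) \<in> mat_kernel (R_mat 2 l I J K T) \<inter> sym_space n K"
      unfolding n_def
      by (intro rank_one_kron_pow_in_kernel[OF I J col_X_carrier]) (simp add: slice_def)
    then show ?thesis using bas(2) by blast
  qed
  then obtain y where y: "\<And>r. r < K \<Longrightarrow> y r \<in> carrier_vec K"
    "\<And>r. r < K \<Longrightarrow> kron_pow n (col X r) = N *\<^sub>v y r" by metis
  define F where "F = mat K K (\<lambda>(q, r). y r $ q)"
  \<comment> \<open>The rows of \<open>D\<close> are the \<open>n\<close>-th powers of the columns of \<open>C\<close>.\<close>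
  define D where "D = mat K (K ^ n) (\<lambda>(s, c). \<Prod>p<n. C $$ (digit K n c p, s))"
  have F: "F \<in> carrier_mat K K" and D: "D \<in> carrier_mat K (K ^ n)"
    by (simp_all add: F_def D_def)
  have NF: "X_pow n = N * F"
  proof (rule eq_matI)
    fix c r assume "c < dim_row (N * F)" "r < dim_col (N * F)"
    then have cr: "c < K ^ n" "r < K" using bas(1) by (auto simp: F_def)
    have "col F r = y r" using cr y(1)[of r] by (auto simp: F_def)
    then show "X_pow n $$ (c, r) = (N * F) $$ (c, r)"
      using cr y(2)[of r] bas(1) F by (simp add: X_pow_def)
  qed (use bas(1) in \<open>simp_all add: F_def X_pow_def\<close>)
  have DX: "D * X_pow n = 1\<^sub>m K"
  proof (rule eq_matI)
    fix s r assume "s < dim_row (1\<^sub>m K)" "r < dim_col (1\<^sub>m K)"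
    then have sr: "s < K" "r < K" by auto
    have "(D * X_pow n) $$ (s, r) = (\<Sum>c<K ^ n. (\<Prod>p<n. C $$ (digit K n c p, s)) * X_pow n $$ (c, r))"
      using sr X_pow_carrier[of n] D by (simp add: scalar_prod_def atLeast0LessThan D_def)
    also have "\<dots> = 1\<^sub>m K $$ (s, r)"
      using sr n by (simp add: X_pow_contract[where y = "\<lambda>_ v. C $$ (v, s)"] C_X power_0_left)
    finally show "(D * X_pow n) $$ (s, r) = 1\<^sub>m K $$ (s, r)" .
  qed (simp_all add: D_def X_pow_def)
  define G where "G = D * N"
  have G: "G \<in> carrier_mat K K" using D bas(1) by (simp add: G_def)
  have GF: "G * F = 1\<^sub>m K"
    using DX unfolding NF G_def by (simp add: assoc_mult_mat[OF D bas(1) F])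
  have FG: "F * G = 1\<^sub>m K"
    by (rule mat_mult_left_right_inverse[OF G F GF])
  have "N = N * (F * G)" using bas(1) FG by simp
  also have "\<dots> = X_pow n * G"
    using NF assoc_mult_mat[OF bas(1) F G] by simp
  finally show ?thesis
    by (rule that[OF F G FG GF])
qed

text \<open>
  The heart of the uniqueness proof. The \<open>n\<close>-th power of \<open>x\<close> lies in the kernel, so it is a combination of the
  powers of the dual basis. Such a combination has no mixed components, whereas the \<open>n\<close>-th power of \<open>x\<close> has the
  mixed component \<open>coord x r * coord x s ^ (n - 1)\<close>.
\<close>

lemma rank_one_imp_single_coord:
  assumes x: "x \<in> carrier_vec K" and ab: "\<And>i j. i < I \<Longrightarrow> j < J \<Longrightarrow> slice x i j = a i * b j"
    and rs: "r < K" "s < K" "r \<noteq> s"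
  shows "coord x r = 0 \<or> coord x s = 0"
proof -
  define n where "n = 2 + l"
  obtain N where N: "basis_mat (K ^ n) (mat_kernel sym_mat) N"
    unfolding n_def using basis_mat_kernel_exists[OF sym_kernel_mat_carrier] by blast
  obtain F G where FG: "F \<in> carrier_mat K K" "G \<in> carrier_mat K K"
    "F * G = 1\<^sub>m K" "G * F = 1\<^sub>m K" "N = X_pow n * G"
    by (rule kernel_basis_factor[OF n_def N])
  have "kron_pow n x \<in> mat_kernel sym_mat"
    unfolding kernel_sym_mat n_def
    by (rule rank_one_kron_pow_in_kernel[OF I J x]) (simp add: ab flip: slice_def)
  then obtain y where y: "y \<in> carrier_vec K" "kron_pow n x = N *\<^sub>v y"
    using basis_mat_kernel(2)[OF sym_kernel_mat_carrier N[unfolded n_def], unfolded kernel_sym_mat dim_kernel]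
    unfolding kernel_sym_mat n_def by blast
  define z where "z = G *\<^sub>v y"
  have z: "z \<in> carrier_vec K" "kron_pow n x = X_pow n *\<^sub>v z"
    using y FG(2,5) assoc_mult_mat_vec[OF X_pow_carrier FG(2) y(1)] by (simp_all add: z_def)
  \<comment> \<open>Contract the first factor with the column \<open>r\<close> of \<open>C\<close> and the others with the column \<open>s\<close>.\<close>
  define u where "u p v = C $$ (v, if p = 0 then r else s)" for p v :: nat
  have split: "(\<Prod>p<n. f p) = f 0 * f 1 * (\<Prod>p<l. f (2 + p))" for f :: "nat \<Rightarrow> real"
    by (simp add: n_def numeral_2_eq_2 prod.lessThan_Suc_shift del: prod.lessThan_Suc)
  have "coord x r * coord x s ^ (l + 1) = (\<Prod>p<n. \<Sum>v<K. u p v * x $ v)"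
    by (simp add: split u_def coord_def)
  also have "\<dots> = (\<Sum>c<K ^ n. (\<Prod>p<n. u p (digit K n c p)) * (X_pow n *\<^sub>v z) $ c)"
    using kron_pow_prod_contract[OF x, where n = n and y = u] by (simp add: z(2))
  also have "\<dots> = (\<Sum>c<K ^ n. \<Sum>q<K. ((\<Prod>p<n. u p (digit K n c p)) * X_pow n $$ (c, q)) * z $ q)"
    using X_pow_carrier[of n] z(1)
    by (simp add: scalar_prod_def atLeast0LessThan sum_distrib_left mult.assoc)
  also have "\<dots> = (\<Sum>q<K. (\<Prod>p<n. \<Sum>v<K. u p v * X $$ (v, q)) * z $ q)"
    by (subst sum.swap) (simp add: sum_distrib_right[symmetric] X_pow_contract)
  also have "\<dots> = 0"
    using rs by (intro sum.neutral) (auto simp: split u_def C_X)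
  finally show ?thesis by auto
qed

text \<open>
  If the term \<open>q\<close> vanished, the slice at the sum of two dual basis vectors, one of them the one for \<open>q\<close>, would
  still have rank at most one. There are two of them since \<open>K \<ge> 2\<close>.
\<close>

lemma rank_one_terms_nonzero:
  assumes q: "q < K"
  shows "\<exists>i<I. \<exists>j<J. A $$ (i, q) * B $$ (j, q) \<noteq> 0"
proof (rule ccontr)
  assume "\<not> ?thesis"
  then have 0: "A $$ (i, q) * B $$ (j, q) = 0" if "i < I" "j < J" for i j
    using that by blast
  define s where "s = (if q = 0 then 1 else 0 :: nat)"
  have s: "s < K" "s \<noteq> q" using K by (auto simp: s_def)
  define x where "x = vec K (\<lambda>v. \<Sum>r<K. X $$ (v, r) * of_bool (r = q \<or> r = s))"
  have coord: "coord x r = of_bool (r = q \<or> r = s)" if "r < K" for r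
    unfolding x_def using that by (rule coord_X)
  have "slice x i j = A $$ (i, s) * B $$ (j, s)" if "i < I" "j < J" for i j
  proof -
    have "slice x i j = (\<Sum>r<K. if r = s then A $$ (i, s) * B $$ (j, s) else 0)"
      unfolding slice_eq[OF that] using 0[OF that] by (intro sum.cong refl) (auto simp: coord)
    then show ?thesis using s by simp
  qed
  then have "coord x q = 0 \<or> coord x s = 0"
    using q s by (intro rank_one_imp_single_coord[of x "\<lambda>i. A $$ (i, s)" "\<lambda>j. B $$ (j, s)"]) (auto simp: x_def)
  then show False using q s by (simp add: coord)
qed

text \<open>
  A zero slice has rank at most one, so it belongs to a multiple of a dual basis vector, where the slice is a
  multiple of a nonzero rank-one term.
\<close>

lemma slice_eq_0_imp:
  assumes x: "x \<in> carrier_vec K" and 0: "\<And>i j. i < I \<Longrightarrow> j < J \<Longrightarrow> slice x i j = 0"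
  shows "x = 0\<^sub>v K"
proof (rule coord_eq_0_imp[OF x], rule ccontr)
  fix q assume q: "q < K" "coord x q \<noteq> 0"
  have "coord x r = 0" if "r < K" "r \<noteq> q" for r
    using rank_one_imp_single_coord[of x "\<lambda>_. 0" "\<lambda>_. 0" r q] x 0 q that by auto
  then have "coord x q * (A $$ (i, q) * B $$ (j, q)) = 0" if "i < I" "j < J" for i j
    using slice_single_coord[of q x i j] 0 q that by simp
  then show False using rank_one_terms_nonzero[OF q(1)] q(2) by auto
qed

section \<open>Rank and uniqueness\<close>

text \<open>
  Otherwise some nonzero vector is orthogonal to all columns of \<open>C'\<close>, and the slice there is zero.
\<close>

lemma pd_third_factor_nonsingular:
  assumes pd': "is_pd I J K R T A' B' C'" and R: "R \<le> K"
  shows "R = K \<and> det C' \<noteq> 0"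
proof (rule ccontr)
  assume contr: "\<not> ?thesis"
  have C': "C' \<in> carrier_mat K R" using pd' by (simp add: is_pd_def)
  \<comment> \<open>The transpose of \<open>C'\<close>, padded with zero rows to a square matrix.\<close>
  define M where "M = mat K K (\<lambda>(r, v). if r < R then C' $$ (v, r) else 0)"
  have M: "M \<in> carrier_mat K K" by (simp add: M_def)
  have "det M = 0"
  proof (cases "R = K")
    case True
    then have "M = C'\<^sup>T" using C' by (auto simp: M_def)
    then show ?thesis using contr True C' det_transpose[of C' K] by simp
  next
    case False
    then have "R < K" using R by simp
    have "M\<^sup>T *\<^sub>v unit_vec K R = 0\<^sub>v K"
      using \<open>R < K\<close> M by (auto simp: M_def scalar_prod_right_unit)
    then have "det (M\<^sup>T) = 0"
      using \<open>R < K\<close> M by (subst det_0_iff_vec_prod_zero[of _ K]) (auto intro!: exI[of _ "unit_vec K R"])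
    then show ?thesis using det_transpose[OF M] by simp
  qed
  then obtain x where x: "x \<in> carrier_vec K" "x \<noteq> 0\<^sub>v K" "M *\<^sub>v x = 0\<^sub>v K"
    using det_0_iff_vec_prod_zero[OF M] by blast
  have "(\<Sum>v<K. C' $$ (v, r) * x $ v) = 0" if "r < R" for r
    using that R x(1) arg_cong[OF x(3), of "\<lambda>y. y $ r"]
    by (simp add: M_def scalar_prod_def atLeast0LessThan)
  then have "slice x i j = 0" if "i < I" "j < J" for i j
    by (simp add: slice_of_pd[OF pd' that])
  then show False using slice_eq_0_imp x by blast
qed

lemma tensor_rank_eq: "tensor_rank I J K T = K"
  unfolding tensor_rank_def
proof (rule Least_equality)
  show "\<exists>A B C. is_pd I J K K T A B C" using pd by blast
  fix R assume "\<exists>A B C. is_pd I J K R T A B C"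
  then show "K \<le> R" using pd_third_factor_nonsingular by (metis nle_le)
qed

end

lemma outer_product_proportional:
  fixes a a' :: "'i \<Rightarrow> 'a :: field" and b b' :: "'j \<Rightarrow> 'a"
  assumes eq: "\<And>i j. i \<in> S \<Longrightarrow> j \<in> S' \<Longrightarrow> a' i * b' j = e * (a i * b j)"
    and e: "e \<noteq> 0" and nz: "i0 \<in> S" "j0 \<in> S'" "a i0 * b j0 \<noteq> 0"
  obtains \<alpha> \<beta> where "\<alpha> * \<beta> = e" "\<And>i. i \<in> S \<Longrightarrow> a' i = \<alpha> * a i" "\<And>j. j \<in> S' \<Longrightarrow> b' j = \<beta> * b j"
proof -
  have nz': "a' i0 * b' j0 \<noteq> 0" using eq[OF nz(1,2)] e nz(3) by simp
  show ?thesis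
  proof (rule that[of "e * b j0 / b' j0" "e * a i0 / a' i0"])
    show "e * b j0 / b' j0 * (e * a i0 / a' i0) = e"
      using eq[OF nz(1,2)] nz' e by (simp add: field_simps)
    show "a' i = e * b j0 / b' j0 * a i" if "i \<in> S" for i
      using eq[OF that nz(2)] nz' by (simp add: field_simps)
    show "b' j = e * a i0 / a' i0 * b j" if "j \<in> S'" for j
      using eq[OF nz(1) that] nz' by (simp add: field_simps)
  qed
qed

lemma nonsing_diag_mat_diag:
  assumes "\<And>i. i < n \<Longrightarrow> f i \<noteq> 0"
  shows "nonsing_diag_mat n (mat_diag n f)"
proof -
  have "mat_diag n f * mat_diag n (\<lambda>i. inverse (f i)) = 1\<^sub>m n"
    "mat_diag n (\<lambda>i. inverse (f i)) * mat_diag n f = 1\<^sub>m n"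
    using assms unfolding mat_diag_diag by (auto simp: mat_diag_def intro!: eq_matI)
  then have "invertible_mat (mat_diag n f)"
    unfolding invertible_mat_def inverts_mat_def by (auto simp: mat_diag_def)
  then show ?thesis
    by (simp add: nonsing_diag_mat_def diagonal_mat_def mat_diag_def)
qed

lemma mult_permutation_diag:
  fixes M :: "'a :: comm_ring_1 mat"
  assumes M: "M \<in> carrier_mat m n" and \<pi>: "\<pi> permutes {..<n}"
  shows "M * mat n n (\<lambda>(i, j). if i = \<pi> j then 1 else 0) * mat_diag n f
    = mat m n (\<lambda>(i, j). M $$ (i, \<pi> j) * f j)"
proof -
  let ?P = "mat n n (\<lambda>(i, j). if i = \<pi> j then 1 else 0)"
  have MP: "M * ?P = mat m n (\<lambda>(i, j). M $$ (i, \<pi> j))"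
  proof (rule eq_matI)
    fix i j assume "i < dim_row (mat m n (\<lambda>(i, j). M $$ (i, \<pi> j)))"
      "j < dim_col (mat m n (\<lambda>(i, j). M $$ (i, \<pi> j)))"
    then have ij: "i < m" "j < n" by auto
    then have "\<pi> j < n" using permutes_in_image[OF \<pi>, of j] by simp
    then show "(M * ?P) $$ (i, j) = mat m n (\<lambda>(i, j). M $$ (i, \<pi> j)) $$ (i, j)"
      using ij M by (simp add: scalar_prod_def if_distrib[of "\<lambda>t. _ * t"] cong: if_cong)
  qed (use M in auto)
  show ?thesis
    unfolding MP by (subst mat_diag_mult_right[where nr = m]) (auto intro!: eq_matI)
qed

context cpd_kernel
begin

text \<open>
  The slices at the dual basis \<open>x 0, x 1, \<dots>\<close> of \<open>C'\<close> have rank at most one, so \<open>x q\<close> is a multiple of one dual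
  basis vector of \<open>C\<close>; its index is \<open>\<pi> q\<close> and the factor is \<open>e q\<close>. Comparing the slices at \<open>x q\<close> relates the first two
  factors, and dualizing back relates \<open>C'\<close> to \<open>C\<close>.
\<close>

lemma pd_equivalent:
  assumes pd': "is_pd I J K K T A' B' C'"
  obtains \<pi> \<alpha> \<beta> e where "\<pi> permutes {..<K}"
    "\<And>q. q < K \<Longrightarrow> e q \<noteq> 0" "\<And>q. q < K \<Longrightarrow> \<alpha> q * \<beta> q = e q"
    "\<And>i q. i < I \<Longrightarrow> q < K \<Longrightarrow> A' $$ (i, q) = \<alpha> q * A $$ (i, \<pi> q)"
    "\<And>j q. j < J \<Longrightarrow> q < K \<Longrightarrow> B' $$ (j, q) = \<beta> q * B $$ (j, \<pi> q)"
    "\<And>v q. v < K \<Longrightarrow> q < K \<Longrightarrow> C' $$ (v, q) = inverse (e q) * C $$ (v, \<pi> q)"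
proof -
  have C': "C' \<in> carrier_mat K K" "det C' \<noteq> 0"
    using pd' pd_third_factor_nonsingular[OF pd'] by (auto simp: is_pd_def)
  obtain X' where X': "X' \<in> carrier_mat K K"
    "\<And>r q. r < K \<Longrightarrow> q < K \<Longrightarrow> (\<Sum>v<K. C' $$ (v, r) * X' $$ (v, q)) = of_bool (r = q)"
    "\<And>w v. w < K \<Longrightarrow> v < K \<Longrightarrow> (\<Sum>s<K. X' $$ (w, s) * C' $$ (v, s)) = of_bool (w = v)"
    by (rule dual_basis[OF C']) blast
  define x where "x q = vec K (\<lambda>v. X' $$ (v, q))" for q
  have x: "x q \<in> carrier_vec K" for q by (simp add: x_def)
  have slice_x: "slice (x q) i j = A' $$ (i, q) * B' $$ (j, q)" if "i < I" "j < J" "q < K" for i j q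
    using that
    by (simp add: slice_of_pd[OF pd'] x_def X'(2) of_bool_def if_distrib[of "\<lambda>t. _ * t"] cong: if_cong)
  have x_nz: "\<exists>r<K. coord (x q) r \<noteq> 0" if q: "q < K" for q
  proof (rule ccontr)
    assume "\<not> ?thesis"
    then have "x q = 0\<^sub>v K" using coord_eq_0_imp[OF x] by blast
    then have "X' $$ (v, q) = 0" if "v < K" for v
      using that by (metis x_def index_vec index_zero_vec(1))
    then show False using X'(2)[OF q q] by simp
  qed
  then obtain \<pi>0 where \<pi>0: "\<And>q. q < K \<Longrightarrow> \<pi>0 q < K" "\<And>q. q < K \<Longrightarrow> coord (x q) (\<pi>0 q) \<noteq> 0"
    by metis
  define \<pi> where "\<pi> q = (if q < K then \<pi>0 q else q)" for q
  define e where "e q = coord (x q) (\<pi> q)" for q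
  have \<pi>: "\<pi> q < K" and e: "e q \<noteq> 0" if "q < K" for q
    using \<pi>0 that by (auto simp: \<pi>_def e_def)
  have coord_x: "coord (x q) r = (if r = \<pi> q then e q else 0)" if "q < K" "r < K" for q r
    using rank_one_imp_single_coord[OF x slice_x[OF _ _ that(1)] that(2) \<pi>[OF that(1)]] e[OF that(1)]
    by (auto simp: e_def)
  have inj: "inj_on \<pi> {..<K}"
  proof (rule inj_onI, rule ccontr, unfold lessThan_iff)
    fix q q' assume q: "q < K" "q' < K" "\<pi> q = \<pi> q'" "q \<noteq> q'"
    \<comment> \<open>If \<open>x q\<close> and \<open>x q'\<close> were parallel, this combination of them would vanish.\<close>
    define y where "y = vec K (\<lambda>v. e q' * X' $$ (v, q) - e q * X' $$ (v, q'))"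
    have "coord y r = e q' * coord (x q) r - e q * coord (x q') r" for r
      by (simp add: coord_def y_def x_def right_diff_distrib sum_subtractf sum_distrib_left mult_ac)
    then have "y = 0\<^sub>v K"
      using q by (intro coord_eq_0_imp) (simp_all add: y_def coord_x)
    then have "(\<Sum>v<K. C' $$ (v, q) * y $ v) = 0" by simp
    also have "(\<Sum>v<K. C' $$ (v, q) * y $ v)
      = e q' * (\<Sum>v<K. C' $$ (v, q) * X' $$ (v, q)) - e q * (\<Sum>v<K. C' $$ (v, q) * X' $$ (v, q'))"
      by (simp add: y_def right_diff_distrib sum_subtractf sum_distrib_left mult_ac)
    finally show False using q e X'(2) by simp
  qed
  have perm: "\<pi> permutes {..<K}"
  proof (rule bij_imp_permutes)
    show "bij_betw \<pi> {..<K} {..<K}"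
      using inj \<pi> by (simp add: inj_on_finite bij_betw_def endo_inj_surj image_subset_iff)
    show "\<pi> q = q" if "q \<notin> {..<K}" for q using that by (simp add: \<pi>_def)
  qed
  have "\<exists>\<alpha> \<beta>. \<alpha> * \<beta> = e q \<and> (\<forall>i<I. A' $$ (i, q) = \<alpha> * A $$ (i, \<pi> q)) \<and>
      (\<forall>j<J. B' $$ (j, q) = \<beta> * B $$ (j, \<pi> q))" if q: "q < K" for q
  proof -
    have eq: "A' $$ (i, q) * B' $$ (j, q) = e q * (A $$ (i, \<pi> q) * B $$ (j, \<pi> q))" if "i < I" "j < J" for i j
      using slice_single_coord[of "\<pi> q" "x q" i j] slice_x that q \<pi> coord_x by simp
    obtain i0 j0 where nz: "i0 < I" "j0 < J" "A $$ (i0, \<pi> q) * B $$ (j0, \<pi> q) \<noteq> 0"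
      using rank_one_terms_nonzero[OF \<pi>[OF q]] by blast
    show ?thesis
      by (rule outer_product_proportional[of "{..<I}" "{..<J}" "\<lambda>i. A' $$ (i, q)" "\<lambda>j. B' $$ (j, q)"
            "e q" "\<lambda>i. A $$ (i, \<pi> q)" "\<lambda>j. B $$ (j, \<pi> q)" i0 j0])
        (use eq nz e[OF q] in auto)
  qed
  then obtain \<alpha> \<beta> where \<alpha>\<beta>: "\<And>q. q < K \<Longrightarrow> \<alpha> q * \<beta> q = e q"
    "\<And>i q. i < I \<Longrightarrow> q < K \<Longrightarrow> A' $$ (i, q) = \<alpha> q * A $$ (i, \<pi> q)"
    "\<And>j q. j < J \<Longrightarrow> q < K \<Longrightarrow> B' $$ (j, q) = \<beta> q * B $$ (j, \<pi> q)"
    by metis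
  have C'_eq: "C' $$ (v, q) = inverse (e q) * C $$ (v, \<pi> q)" if v: "v < K" and q: "q < K" for v q
  proof -
    have "C $$ (v, \<pi> q) = (\<Sum>w<K. C $$ (w, \<pi> q) * (\<Sum>s<K. X' $$ (w, s) * C' $$ (v, s)))"
      using v by (simp add: X'(3) of_bool_def if_distrib[of "\<lambda>t. _ * t"] cong: if_cong)
    also have "\<dots> = (\<Sum>w<K. \<Sum>s<K. C $$ (w, \<pi> q) * X' $$ (w, s) * C' $$ (v, s))"
      by (simp add: sum_distrib_left mult.assoc)
    also have "\<dots> = (\<Sum>s<K. coord (x s) (\<pi> q) * C' $$ (v, s))"
      by (subst sum.swap) (simp add: coord_def x_def sum_distrib_right)
    also have "\<dots> = (\<Sum>s<K. if s = q then e q * C' $$ (v, q) else 0)"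
    proof (rule sum.cong[OF refl])
      fix s assume "s \<in> {..<K}"
      then have s: "s < K" by simp
      show "coord (x s) (\<pi> q) * C' $$ (v, s) = (if s = q then e q * C' $$ (v, q) else 0)"
        using coord_x[OF s \<pi>[OF q]] inj_onD[OF inj, of s q] s q by auto
    qed
    also have "\<dots> = e q * C' $$ (v, q)" using q by simp
    finally show ?thesis using e[OF q] by (simp add: field_simps)
  qed
  show ?thesis
    by (rule that[OF perm e \<alpha>\<beta> C'_eq])
qed

lemma pd_permuted_scaled:
  assumes pd': "is_pd I J K K T A' B' C'"
  shows "\<exists>P L1 L2 L3. permutation_mat K P \<and>
    nonsing_diag_mat K L1 \<and> nonsing_diag_mat K L2 \<and> nonsing_diag_mat K L3 \<and>
    L1 * L2 * L3 = 1\<^sub>m K \<and> A' = A * P * L1 \<and> B' = B * P * L2 \<and> C' = C * P * L3"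
proof -
  obtain \<pi> \<alpha> \<beta> e where \<pi>: "\<pi> permutes {..<K}"
    and e: "\<And>q. q < K \<Longrightarrow> e q \<noteq> 0" and \<alpha>\<beta>: "\<And>q. q < K \<Longrightarrow> \<alpha> q * \<beta> q = e q"
    and A': "\<And>i q. i < I \<Longrightarrow> q < K \<Longrightarrow> A' $$ (i, q) = \<alpha> q * A $$ (i, \<pi> q)"
    and B': "\<And>j q. j < J \<Longrightarrow> q < K \<Longrightarrow> B' $$ (j, q) = \<beta> q * B $$ (j, \<pi> q)"
    and C': "\<And>v q. v < K \<Longrightarrow> q < K \<Longrightarrow> C' $$ (v, q) = inverse (e q) * C $$ (v, \<pi> q)"
    by (rule pd_equivalent[OF pd']) blast
  let ?P = "mat K K (\<lambda>(i, j). if i = \<pi> j then 1 else 0) :: real mat"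
  have "permutation_mat K ?P"
    unfolding permutation_mat_def using \<pi> by blast
  moreover have "\<alpha> q \<noteq> 0" "\<beta> q \<noteq> 0" if "q < K" for q
    using e[OF that] \<alpha>\<beta>[OF that] by auto
  then have "nonsing_diag_mat K (mat_diag K \<alpha>)" "nonsing_diag_mat K (mat_diag K \<beta>)"
    "nonsing_diag_mat K (mat_diag K (\<lambda>q. inverse (e q)))"
    using e by (auto intro!: nonsing_diag_mat_diag)
  moreover have "mat_diag K \<alpha> * mat_diag K \<beta> * mat_diag K (\<lambda>q. inverse (e q)) = 1\<^sub>m K"
    using e by (auto simp: mat_diag_diag \<alpha>\<beta> intro!: eq_matI) (auto simp: mat_diag_def \<alpha>\<beta>)
  moreover have "A' = A * ?P * mat_diag K \<alpha>" "B' = B * ?P * mat_diag K \<beta>"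
    "C' = C * ?P * mat_diag K (\<lambda>q. inverse (e q))"
    unfolding mult_permutation_diag[OF carrier(1) \<pi>] mult_permutation_diag[OF carrier(2) \<pi>]
      mult_permutation_diag[OF carrier(3) \<pi>]
    using pd' by (auto simp: is_pd_def A' B' C' intro!: eq_matI)
  ultimately show ?thesis by blast
qed

end

text \<open>
  Uniqueness compares two arbitrary CPDs, neither of which has to be the one given by the hypotheses. The
  first of them satisfies the same hypotheses, since the kernel condition concerns only \<open>T\<close>.
\<close>

lemma cpd_unique_if_kernel_dim:
  assumes "cpd_kernel I J K l T A B C"
  shows "cpd_unique I J K T"
  unfolding cpd_unique_def is_cpd_def Let_def
proof (intro allI impI)
  interpret cpd_kernel I J K l T A B C by fact
  fix A1 B1 C1 A2 B2 C2
  assume cpds: "is_pd I J K (tensor_rank I J K T) T A1 B1 C1 \<and> is_pd I J K (tensor_rank I J K T) T A2 B2 C2"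
  then have pd1: "is_pd I J K K T A1 B1 C1" and pd2: "is_pd I J K K T A2 B2 C2"
    by (simp_all add: tensor_rank_eq)
  interpret one: cpd_kernel I J K l T A1 B1 C1
    using I J K pd1 pd_third_factor_nonsingular[OF pd1] dim_kernel by unfold_locales auto
  show "\<exists>P L1 L2 L3. permutation_mat (tensor_rank I J K T) P \<and>
      nonsing_diag_mat (tensor_rank I J K T) L1 \<and> nonsing_diag_mat (tensor_rank I J K T) L2 \<and>
      nonsing_diag_mat (tensor_rank I J K T) L3 \<and> L1 * L2 * L3 = 1\<^sub>m (tensor_rank I J K T) \<and>
      A2 = A1 * P * L1 \<and> B2 = B1 * P * L2 \<and> C2 = C1 * P * L3"
    unfolding tensor_rank_eq by (rule one.pd_permuted_scaled[OF pd2])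
qed

section \<open>Moment curves\<close>

text \<open>
  A nonzero vector \<open>f s\<close> is orthogonal to the point with parameter \<open>t\<close> of the moment curve only if \<open>t\<close> is a
  root of a nonzero polynomial of degree less than \<open>d\<close>. The bound on \<open>t\<close> does not depend on the vectors, which
  allows a program to enumerate the candidates.
\<close>

lemma moment_curve_avoids:
  fixes f :: "'s \<Rightarrow> nat \<Rightarrow> real"
  assumes S: "finite S" and nz: "\<And>s. s \<in> S \<Longrightarrow> \<exists>j<d. f s j \<noteq> 0"
  shows "\<exists>t\<le>card S * d. \<forall>s\<in>S. (\<Sum>j<d. of_nat t ^ j * f s j) \<noteq> 0"
proof (rule ccontr)
  assume contr: "\<not> ?thesis"
  define p where "p s = (\<Sum>j<d. monom (f s j) j)" for s
  have poly: "poly (p s) x = (\<Sum>j<d. x ^ j * f s j)" for s x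
    by (simp add: p_def poly_sum poly_monom mult.commute)
  have roots: "card {x. poly (p s) x = 0} \<le> d" "finite {x. poly (p s) x = 0}" if s: "s \<in> S" for s
  proof -
    obtain j where "j < d" "f s j \<noteq> 0" using nz[OF s] by blast
    moreover have "coeff (p s) j = f s j" if "j < d" for j
      using that by (simp add: p_def coeff_sum)
    ultimately have "p s \<noteq> 0" by (metis coeff_0)
    moreover have "degree (p s) \<le> d"
      unfolding p_def
      by (rule degree_sum_le) (auto intro: order.trans[OF degree_monom_le])
    ultimately show "card {x. poly (p s) x = 0} \<le> d" "finite {x. poly (p s) x = 0}"
      using card_poly_roots_bound poly_roots_finite by (metis order.trans, metis)
  qed
  have "Suc (card S * d) = card (real ` {..card S * d})"
    by (subst card_image) (auto simp: inj_on_def)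
  also have "\<dots> \<le> card (\<Union>s\<in>S. {x. poly (p s) x = 0})"
    using contr S roots(2) by (intro card_mono) (auto simp: poly)
  also have "\<dots> \<le> (\<Sum>s\<in>S. card {x. poly (p s) x = 0})"
    by (rule card_UN_le[OF S])
  also have "\<dots> \<le> card S * d"
    using sum_bounded_above[of S "\<lambda>s. card {x. poly (p s) x = 0}" d] roots(1) by simp
  finally show False by simp
qed

lemma det_mat_diag: "det (mat_diag n f) = (\<Prod>i<n. f i)"
proof -
  have "det (mat_diag n f) = prod_list (diag_mat (mat_diag n f))"
    by (rule det_upper_triangular) (auto simp: mat_diag_def upper_triangular_def)
  then show ?thesis
    by (simp add: prod_list_diag_prod mat_diag_def atLeast0LessThan)
qed

section \<open>Recovering the factors from a basis of the kernel\<close>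

text \<open>
  The columns of \<open>N\<close> are read as \<open>K \<times> d\<close> matrices, whose second index is contracted with a point of the moment
  curve.
\<close>

definition moment_slice :: "nat \<Rightarrow> nat \<Rightarrow> real mat \<Rightarrow> nat \<Rightarrow> real mat" where
  "moment_slice d K N t = mat K K (\<lambda>(k, c). \<Sum>j<d. of_nat t ^ j * N $$ (k * d + j, c))"

lemma moment_slice_carrier: "moment_slice d K N t \<in> carrier_mat K K"
  by (simp add: moment_slice_def)

text \<open>
  The matrix \<open>N\<close> is a basis of the symmetric kernel, in the form provided by \<open>kernel_basis_factor\<close>. The
  factors \<open>F\<close> and \<open>G\<close> are not known to the algorithm.
\<close>

locale cpd_kernel_basis = cpd_kernel +
  fixes d :: nat and N F G :: "real mat"
  assumes d: "d = K ^ Suc l"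
    and F: "F \<in> carrier_mat K K" and G: "G \<in> carrier_mat K K"
    and FG: "F * G = 1\<^sub>m K" and GF: "G * F = 1\<^sub>m K"
    and N: "N = X_pow (2 + l) * G"
begin

definition moment :: "nat \<Rightarrow> nat \<Rightarrow> real" where
  "moment t r = (\<Sum>j<d. of_nat t ^ j * X_pow (Suc l) $$ (j, r))"

abbreviation N_slice :: "nat \<Rightarrow> real mat" where
  "N_slice t \<equiv> moment_slice d K N t"

lemma mult_square [simp]:
  "M \<in> carrier_mat K K \<Longrightarrow> M' \<in> carrier_mat K K \<Longrightarrow> M * M' \<in> carrier_mat K K"
  by (rule mult_carrier_mat)

lemmas assoc_square = assoc_mult_mat[of _ K K _ K _ K]

lemma carrier_simps [simp]:
  "transpose_mat C \<in> carrier_mat K K" "X \<in> carrier_mat K K" "F \<in> carrier_mat K K" "G \<in> carrier_mat K K"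
  "moment_slice d' K N' t \<in> carrier_mat K K"
  "dim_row C = K" "dim_col C = K" "dim_row X = K" "dim_col X = K"
  "dim_row F = K" "dim_col F = K" "dim_row G = K" "dim_col G = K"
  using carrier(3) X_carrier F G moment_slice_carrier by auto

text \<open>
  A column of \<open>X_pow (2 + l)\<close>, read as a \<open>K \<times> d\<close> matrix, is the rank-one matrix \<open>x y\<^sup>T\<close> with \<open>x\<close> a column of \<open>X\<close> and
  \<open>y\<close> its power of exponent \<open>l + 1\<close>. So contracting the second index scales \<open>x\<close> by a number, the \<open>moment\<close>.
\<close>

lemma moment_slice_factor: "N_slice t = X * mat_diag K (moment t) * G"
proof (rule eq_matI)
  fix k c assume "k < dim_row (X * mat_diag K (moment t) * G)" "c < dim_col (X * mat_diag K (moment t) * G)"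
  then have kc: "k < K" "c < K" using X_carrier G by auto
  have N_index: "N $$ (k * d + j, c) = (\<Sum>r<K. X $$ (k, r) * X_pow (Suc l) $$ (j, r) * G $$ (r, c))"
    if j: "j < d" for j
  proof -
    have lt: "k * d + j < K ^ (2 + l)"
      using mult_add_less[OF kc(1) j] by (simp add: d)
    have "X_pow (2 + l) $$ (k * d + j, r) = X $$ (k, r) * X_pow (Suc l) $$ (j, r)" if r: "r < K" for r
    proof -
      have "X_pow (2 + l) $$ (k * d + j, r) = kron_pow (Suc (Suc l)) (col X r) $ (k * K ^ Suc l + j)"
        using lt r unfolding X_pow_def by (simp only: add_2_eq_Suc index_mat(1) prod.case d)
      also have "\<dots> = col X r $ k * kron_pow (Suc l) (col X r) $ j"
        by (rule index_kron_pow_Suc[OF col_X_carrier kc(1) j[unfolded d]])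
      also have "\<dots> = X $$ (k, r) * X_pow (Suc l) $$ (j, r)"
        using kc r j unfolding X_pow_def d by (simp only: index_mat(1) prod.case index_col carrier_simps)
      finally show ?thesis .
    qed
    then show ?thesis
      using lt kc G X_pow_carrier[of "2 + l"]
      by (simp add: N scalar_prod_def atLeast0LessThan del: power_Suc)
  qed
  have "N_slice t $$ (k, c) = (\<Sum>j<d. \<Sum>r<K. of_nat t ^ j * (X $$ (k, r) * X_pow (Suc l) $$ (j, r) * G $$ (r, c)))"
    using kc by (simp add: moment_slice_def N_index sum_distrib_left del: power_Suc)
  also have "\<dots> = (\<Sum>r<K. X $$ (k, r) * moment t r * G $$ (r, c))"
    by (subst sum.swap) (simp add: moment_def sum_distrib_left sum_distrib_right mult_ac del: power_Suc)
  also have "\<dots> = (X * mat_diag K (moment t) * G) $$ (k, c)"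
    using kc G X_carrier by (simp add: mat_diag_mult_right[OF X_carrier] scalar_prod_def atLeast0LessThan)
  finally show "N_slice t $$ (k, c) = (X * mat_diag K (moment t) * G) $$ (k, c)" .
qed (use X_carrier G in \<open>simp_all add: moment_slice_def\<close>)

lemma Ct_X: "C\<^sup>T * X = 1\<^sub>m K"
  using carrier(3) X_carrier
  by (intro eq_matI) (simp_all add: scalar_prod_def atLeast0LessThan C_X of_bool_def)

lemma det_nonzero:
  shows "det X \<noteq> 0" "det G \<noteq> 0"
  using arg_cong[OF Ct_X, of det] arg_cong[OF FG, of det] F G X_carrier carrier(3)
  by (auto simp: det_mult[of _ K])

lemma det_moment_slice: "det (N_slice t) \<noteq> 0 \<longleftrightarrow> (\<forall>r<K. moment t r \<noteq> 0)"
proof -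
  have "det (N_slice t) = det X * (\<Prod>r<K. moment t r) * det G"
    unfolding moment_slice_factor using X_carrier G
    by (subst det_mult[of _ K], simp, simp, subst det_mult[of _ K]) (auto simp: det_mat_diag)
  then show ?thesis using det_nonzero by auto
qed

lemma Ct_moment_slice: "C\<^sup>T * N_slice t = mat_diag K (moment t) * G"
proof -
  have "C\<^sup>T * N_slice t = C\<^sup>T * (X * (mat_diag K (moment t) * G))"
    unfolding moment_slice_factor using X_carrier G by (subst assoc_square) auto
  also have "\<dots> = (C\<^sup>T * X) * (mat_diag K (moment t) * G)"
    using X_carrier G carrier(3) by (subst assoc_square) auto
  also have "\<dots> = mat_diag K (moment t) * G"
    by (simp add: Ct_X left_mult_one_mat[OF mult_square])
  finally show ?thesis .
qed

definition pencil_eigenvalue :: "nat \<Rightarrow> nat \<Rightarrow> nat \<Rightarrow> real" where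
  "pencil_eigenvalue t t' r = moment t' r / moment t r"

text \<open>
  Hence the quotient \<open>S\<close> of two slices is similar to a real diagonal matrix, by the matrix \<open>G\<close> for every choice
  of the parameters.
\<close>

lemma solution_diagonalized:
  assumes S: "S \<in> carrier_mat K K" "N_slice t * S = N_slice t'" and nz: "\<And>r. r < K \<Longrightarrow> moment t r \<noteq> 0"
  shows "G * S = mat_diag K (pencil_eigenvalue t t') * G"
proof -
  have "mat_diag K (moment t) * (G * S) = (mat_diag K (moment t) * G) * S"
    using G S(1) by (subst assoc_square) auto
  also have "\<dots> = C\<^sup>T * (N_slice t * S)"
    unfolding Ct_moment_slice[symmetric] using S(1) moment_slice_carrier carrier(3)
    by (subst assoc_square) auto
  finally have main: "mat_diag K (moment t) * (G * S) = mat_diag K (moment t') * G"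
    by (simp add: S(2) Ct_moment_slice)
  have eq: "moment t r * (G * S) $$ (r, c) = moment t' r * G $$ (r, c)" if "r < K" "c < K" for r c
  proof -
    have "(mat_diag K (moment t) * (G * S)) $$ (r, c) = (mat_diag K (moment t') * G) $$ (r, c)"
      by (simp only: main)
    then show ?thesis
      using that S(1) unfolding mat_diag_mult_left[OF G] mat_diag_mult_left[OF mult_square[OF G S(1)]]
      by (simp del: index_mult_mat)
  qed
  show ?thesis
  proof (rule eq_matI)
    fix r c assume "r < dim_row (mat_diag K (pencil_eigenvalue t t') * G)"
      "c < dim_col (mat_diag K (pencil_eigenvalue t t') * G)"
    then have rc: "r < K" "c < K" using G by (auto simp: mat_diag_def)
    show "(G * S) $$ (r, c) = (mat_diag K (pencil_eigenvalue t t') * G) $$ (r, c)"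
      unfolding mat_diag_mult_left[OF G] using rc eq[OF rc] nz[OF rc(1)]
      by (simp add: pencil_eigenvalue_def field_simps del: index_mult_mat)
  qed (use G S in \<open>auto simp: mat_diag_def\<close>)
qed

lemma eigen_dec_exists:
  assumes S: "S \<in> carrier_mat K K" and GS: "G * S = mat_diag K \<gamma> * G"
  shows "eigen_dec S F (mat_diag K \<gamma>)"
proof -
  have "S * F = F * G * (S * F)" using S F FG by simp
  also have "\<dots> = F * (G * S * F)"
    using S F G by (simp add: assoc_square)
  also have "\<dots> = F * (mat_diag K \<gamma> * (G * F))"
    unfolding GS using F G by (subst assoc_square) auto
  also have "\<dots> = F * mat_diag K \<gamma>"
    using right_mult_one_mat[OF mat_diag_dim[of K \<gamma>]] by (simp only: GF)
  finally have "S * F = F * mat_diag K \<gamma>" .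
  moreover have "invertible_mat F"
    using F G FG GF unfolding invertible_mat_def inverts_mat_def by auto
  ultimately show ?thesis
    unfolding eigen_dec_def using S F
    by (intro exI[of _ K]) (auto simp: diagonal_mat_def mat_diag_def)
qed

text \<open>
  In the coordinates given by \<open>G\<close> the matrix \<open>S\<close> is diagonal. With distinct eigenvalues, an eigenvector of a
  diagonal matrix has only one nonzero coordinate.
\<close>

lemma eigenvector_single_coord:
  assumes S: "S \<in> carrier_mat K K" and GS: "G * S = mat_diag K \<gamma> * G"
    and dec: "eigen_dec S V D" and inj: "inj_on \<gamma> {..<K}" and c: "c < K"
  shows "\<exists>q<K. \<forall>r<K. r \<noteq> q \<longrightarrow> (G * V) $$ (r, c) = 0"
proof -
  from dec S have V: "V \<in> carrier_mat K K" and D: "D \<in> carrier_mat K K" "diagonal_mat D"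
    and SV: "S * V = V * D"
    by (auto simp: eigen_dec_def)
  define Y where "Y = G * V"
  have Y: "Y \<in> carrier_mat K K" using G V by (simp add: Y_def)
  have "mat_diag K \<gamma> * Y = G * S * V"
    unfolding Y_def GS using G V by (subst assoc_square) auto
  also have "\<dots> = Y * D"
    unfolding Y_def using S G V D(1) SV by (simp add: assoc_square)
  finally have eq: "mat_diag K \<gamma> * Y = Y * D" .
  have "\<gamma> r * Y $$ (r, c) = Y $$ (r, c) * D $$ (c, c)" if r: "r < K" for r
  proof -
    have "\<gamma> r * Y $$ (r, c) = (Y * D) $$ (r, c)"
      unfolding eq[symmetric] mat_diag_mult_left[OF Y] using r c by simp
    also have "\<dots> = (\<Sum>i<K. if i = c then Y $$ (r, c) * D $$ (c, c) else 0)"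
    proof -
      have "(Y * D) $$ (r, c) = (\<Sum>i<K. Y $$ (r, i) * D $$ (i, c))"
        using r c Y D(1) by (simp add: scalar_prod_def atLeast0LessThan)
      also have "\<dots> = (\<Sum>i<K. if i = c then Y $$ (r, c) * D $$ (c, c) else 0)"
        using c D by (intro sum.cong refl) (auto simp: diagonal_mat_def)
      finally show ?thesis .
    qed
    finally show ?thesis using c by simp
  qed
  then have same: "\<gamma> r = D $$ (c, c)" if "r < K" "Y $$ (r, c) \<noteq> 0" for r
    using that by (metis mult.commute mult_right_cancel)
  show ?thesis
  proof (cases "\<exists>q<K. Y $$ (q, c) \<noteq> 0")
    case True
    then obtain q where q: "q < K" "Y $$ (q, c) \<noteq> 0" by blast
    then have "Y $$ (r, c) = 0" if "r < K" "r \<noteq> q" for r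
      using same[of r] same[of q] inj_onD[OF inj, of r q] that by auto
    then show ?thesis using q by (auto simp: Y_def)
  next
    case False
    then show ?thesis using c by (auto simp: Y_def)
  qed
qed

text \<open>
  The columns of \<open>N_slice t * V\<close> are therefore multiples of the dual basis vectors, and the slices of \<open>T\<close> there
  are multiples of the rank-one terms.
\<close>

lemma slice_eigenvector:
  assumes V: "V \<in> carrier_mat K K" and single: "\<forall>r<K. r \<noteq> q \<longrightarrow> (G * V) $$ (r, c) = 0"
    and q: "q < K" and c: "c < K"
  obtains h where "\<And>i j. i < I \<Longrightarrow> j < J \<Longrightarrow>
    slice (col (N_slice t * V) c) i j = h * (A $$ (i, q) * B $$ (j, q))"
proof -
  let ?Z = "N_slice t * V"
  have Z: "?Z \<in> carrier_mat K K" using V moment_slice_carrier by auto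
  have "C\<^sup>T * ?Z = mat_diag K (moment t) * (G * V)"
    using V G carrier(3) moment_slice_carrier
    by (subst assoc_mult_mat[of _ K K _ K _ K, symmetric])
      (auto simp: Ct_moment_slice assoc_square)
  then have CZ: "(C\<^sup>T * ?Z) $$ (r, c) = moment t r * (G * V) $$ (r, c)" if "r < K" for r
    using that c V G by (simp add: mat_diag_mult_left[of "G * V" K K])
  have "coord (col ?Z c) r = 0" if r: "r < K" "r \<noteq> q" for r
  proof -
    have "coord (col ?Z c) r = (C\<^sup>T * ?Z) $$ (r, c)"
    proof -
      have "coord x r = col C r \<bullet> x" if "x \<in> carrier_vec K" for x
        using that r(1) by (simp add: coord_def scalar_prod_def atLeast0LessThan)
      from this[of "col ?Z c"] show ?thesis
        using r(1) c Z by (subst index_mult_mat(1)) auto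
    qed
    then show ?thesis using CZ single r by simp
  qed
  then show ?thesis
    using slice_single_coord[OF _ q] by (intro that) blast
qed

text \<open>
  The parameters that lead to a decomposition: the first slice is invertible, the quotient of the two slices
  has distinct eigenvalues, and the third moment vector is orthogonal to no column of \<open>A\<close>.
\<close>

definition good :: "nat \<times> nat \<times> nat \<Rightarrow> bool" where
  "good = (\<lambda>(t, t', u). (\<forall>r<K. moment t r \<noteq> 0) \<and> inj_on (pencil_eigenvalue t t') {..<K} \<and>
    (\<forall>q<K. (\<Sum>i<I. of_nat u ^ i * A $$ (i, q)) \<noteq> 0))"

text \<open>
  Each of the three conditions says that a point of a moment curve avoids finitely many hyperplanes. For
  distinct eigenvalues the hyperplanes are determined by pairs \<open>r \<noteq> q\<close>, and the normal vector of the pair is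
  nonzero because the powers of the dual basis vectors are linearly independent.
\<close>

lemma good_exists:
  assumes b: "K * K * d \<le> b" "K * I \<le> b"
  shows "\<exists>t\<le>b. \<exists>t'\<le>b. \<exists>u\<le>b. good (t, t', u)"
proof -
  have contract: "(\<Sum>j<d. (\<Prod>p<Suc l. C $$ (digit K (Suc l) j p, r)) * X_pow (Suc l) $$ (j, q)) = of_bool (r = q)"
    if "r < K" "q < K" for r q
    using that unfolding d
    by (subst X_pow_contract[where y = "\<lambda>_ v. C $$ (v, r)"]) (simp_all add: C_X)
  have "\<exists>j<d. X_pow (Suc l) $$ (j, r) \<noteq> 0" if r: "r < K" for r
    using contract[OF r r] by (metis (no_types, lifting) lessThan_iff mult_zero_right of_bool_eq(2)
        sum.neutral zero_neq_one)
  then obtain t where t: "t \<le> card {..<K} * d" "\<forall>r\<in>{..<K}. moment t r \<noteq> 0"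
    using moment_curve_avoids[of "{..<K}" d "\<lambda>r j. X_pow (Suc l) $$ (j, r)"] unfolding moment_def by auto
  define P where "P = {(r, q). r < K \<and> q < K \<and> r \<noteq> q}"
  have P: "P \<subseteq> {..<K} \<times> {..<K}" by (auto simp: P_def)
  then have card_P: "finite P" "card P \<le> K * K"
    using finite_subset card_mono[OF _ P] by (auto simp: card_cartesian_product)
  define f where "f = (\<lambda>(r, q) j. X_pow (Suc l) $$ (j, r) * moment t q - X_pow (Suc l) $$ (j, q) * moment t r)"
  have "\<exists>j<d. f s j \<noteq> 0" if s: "s \<in> P" for s
  proof (rule ccontr)
    assume 0: "\<not> ?thesis"
    obtain r q where rq: "s = (r, q)" "r < K" "q < K" "r \<noteq> q" using s by (auto simp: P_def)
    \<comment> \<open>Pair with the power of the column \<open>r\<close> of \<open>C\<close>, which is orthogonal to the power of \<open>x\<^sub>q\<close>.\<close>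
    let ?w = "\<lambda>j. \<Prod>p<Suc l. C $$ (digit K (Suc l) j p, r)"
    have "0 = (\<Sum>j<d. ?w j * f s j)" using 0 by simp
    also have "\<dots> = (\<Sum>j<d. ?w j * X_pow (Suc l) $$ (j, r)) * moment t q
        - (\<Sum>j<d. ?w j * X_pow (Suc l) $$ (j, q)) * moment t r"
      by (simp add: f_def rq(1) right_diff_distrib sum_subtractf sum_distrib_right sum_distrib_left mult_ac del: prod.lessThan_Suc)
    also have "\<dots> = moment t q" using rq by (simp only: contract of_bool_eq) simp
    finally show False using t(2) rq by simp
  qed
  then obtain t' where t': "t' \<le> card P * d" "\<forall>s\<in>P. (\<Sum>j<d. of_nat t' ^ j * f s j) \<noteq> 0"
    using moment_curve_avoids[OF card_P(1), of d f] by auto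
  have "inj_on (pencil_eigenvalue t t') {..<K}"
  proof (rule inj_onI, rule ccontr, unfold lessThan_iff)
    fix r q assume rq: "r < K" "q < K" "pencil_eigenvalue t t' r = pencil_eigenvalue t t' q" "r \<noteq> q"
    have "(\<Sum>j<d. of_nat t' ^ j * f (r, q) j) = moment t' r * moment t q - moment t' q * moment t r"
      by (simp add: f_def moment_def[of t'] right_diff_distrib sum_subtractf sum_distrib_right mult.assoc del: power_Suc)
    also have "\<dots> = 0"
      using rq t(2) by (simp add: pencil_eigenvalue_def field_simps)
    finally show False using t'(2) rq by (auto simp: P_def)
  qed
  moreover have "\<exists>i<I. A $$ (i, q) \<noteq> 0" if "q \<in> {..<K}" for q
    using rank_one_terms_nonzero[of q] that by (metis lessThan_iff mult_zero_left)
  then obtain u where u: "u \<le> card {..<K} * I" "\<forall>q\<in>{..<K}. (\<Sum>i<I. of_nat u ^ i * A $$ (i, q)) \<noteq> 0"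
    using moment_curve_avoids[of "{..<K}" I "\<lambda>q i. A $$ (i, q)"] by auto
  ultimately have "good (t, t', u)" using t(2) by (simp add: good_def)
  moreover have "t \<le> b"
  proof -
    have "t \<le> K * d" using t(1) by simp
    also have "\<dots> \<le> K * K * d" using K by (intro mult_right_mono) auto
    finally show ?thesis using b by simp
  qed
  moreover have "t' \<le> b"
    using t'(1) mult_right_mono[OF card_P(2), of d] b by linarith
  moreover have "u \<le> b" using u(1) b by simp
  ultimately show ?thesis by blast
qed

end

text \<open>
  Factoring a matrix of rank at most one without case distinction: the rows combined with weights \<open>u\<close> give a
  multiple \<open>b'\<close> of \<open>b\<close>, nonzero unless \<open>H = 0\<close>, and \<open>a'\<close> is the least-squares coefficient of the rows with
  respect to \<open>b'\<close>.
\<close>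

lemma rank_one_factor:
  fixes a u :: "nat \<Rightarrow> real" and b :: "nat \<Rightarrow> real"
  assumes H: "\<And>i j. i < I \<Longrightarrow> j < J \<Longrightarrow> H i j = h * (a i * b j)"
    and nz: "(\<Sum>i<I. u i * a i) \<noteq> 0" "\<exists>j<J. b j \<noteq> 0"
    and b': "\<And>j. j < J \<Longrightarrow> b' j = (\<Sum>i<I. u i * H i j)"
    and a': "\<And>i. i < I \<Longrightarrow> a' i = (\<Sum>j<J. H i j * b' j) / (\<Sum>j<J. b' j * b' j)"
    and i: "i < I" and j: "j < J"
  shows "a' i * b' j = H i j"
proof (cases "h = 0")
  case True
  then show ?thesis using H i j b' by simp
next
  case False
  define s where "s = (\<Sum>i<I. u i * a i)"
  let ?q = "\<Sum>j<J. b j * b j"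
  have s: "s \<noteq> 0" using nz(1) by (simp add: s_def)
  obtain j0 where "j0 < J" "b j0 \<noteq> 0" using nz(2) by blast
  then have q: "?q \<noteq> 0"
    by (subst sum_nonneg_eq_0_iff) auto
  have b'_eq: "b' j = h * s * b j" if "j < J" for j
    using that by (simp add: s_def b' H sum_distrib_left sum_distrib_right mult_ac)
  have "a' i = (h * a i * (h * s) * ?q) / ((h * s) * (h * s) * ?q)"
    using i by (simp add: a' b'_eq H sum_distrib_left mult_ac)
  also have "\<dots> = a i / s"
    using q s False by (simp add: field_simps)
  finally show ?thesis
    using s i j by (simp add: b'_eq H)
qed

section \<open>Writing programs\<close>

text \<open>
  Programs are built from functions of the state, so that the syntax of arithmetic expressions stays out of
  the correctness proof. Closure properties show that a function is computed by some expression, and \<open>expr\<close>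
  chooses one; it does not depend on the state, so a program stays a fixed finite object.
\<close>

definition expressible :: "(state \<Rightarrow> real) \<Rightarrow> bool" where
  "expressible f \<longleftrightarrow> (\<exists>e. \<forall>s. aval e s = f s)"

definition expr :: "(state \<Rightarrow> real) \<Rightarrow> aexp" where
  "expr f = (SOME e. \<forall>s. aval e s = f s)"

lemma aval_expr:
  assumes "expressible f"
  shows "aval (expr f) s = f s"
proof -
  have "\<forall>s. aval (expr f) s = f s"
    unfolding expr_def by (rule someI_ex) (use assms in \<open>simp add: expressible_def\<close>)
  then show ?thesis ..
qed

definition entry :: "nat \<Rightarrow> nat \<Rightarrow> nat \<Rightarrow> state \<Rightarrow> real" where
  "entry a i j s = aval (Entry a i j) s"

lemma entry_eq: "s a \<in> carrier_mat nr nc \<Longrightarrow> i < nr \<Longrightarrow> j < nc \<Longrightarrow> entry a i j s = s a $$ (i, j)"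
  by (simp add: entry_def)

named_theorems expressible_intros

lemma expressible_entry [expressible_intros]: "expressible (entry a i j)"
  unfolding expressible_def entry_def by blast

lemma expressible_of_rat: "expressible (\<lambda>s. of_rat c)"
  unfolding expressible_def by (intro exI[of _ "Const c"]) simp

lemma expressible_of_nat [expressible_intros]: "expressible (\<lambda>s. of_nat n)"
  using expressible_of_rat[of "of_nat n"] by simp

lemma expressible_const [expressible_intros]:
  "expressible (\<lambda>s. 0)" "expressible (\<lambda>s. 1)" "expressible (\<lambda>s. numeral k)" "expressible (\<lambda>s. fact n)"
  using expressible_of_nat[of 0] expressible_of_nat[of 1] expressible_of_nat[of "numeral k"]
    expressible_of_nat[of "fact n"]
  by simp_all

lemma expressible_arith [expressible_intros]:
  assumes "expressible f" "expressible g"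
  shows "expressible (\<lambda>s. f s + g s)" "expressible (\<lambda>s. f s - g s)"
    "expressible (\<lambda>s. f s * g s)" "expressible (\<lambda>s. f s / g s)"
  using assms unfolding expressible_def by (metis aval.simps)+

lemma expressible_sum [expressible_intros]:
  assumes "\<And>x. x \<in> S \<Longrightarrow> expressible (f x)"
  shows "expressible (\<lambda>s. \<Sum>x\<in>S. f x s)"
  using assms by (induction S rule: infinite_finite_induct) (auto intro!: expressible_intros)

lemma expressible_prod [expressible_intros]:
  assumes "\<And>x. x \<in> S \<Longrightarrow> expressible (f x)"
  shows "expressible (\<lambda>s. \<Prod>x\<in>S. f x s)"
  using assms by (induction S rule: infinite_finite_induct) (auto intro!: expressible_intros)

lemma expressible_power [expressible_intros]:
  "expressible f \<Longrightarrow> expressible (\<lambda>s. f s ^ n)"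
  by (induction n) (auto intro!: expressible_intros)

lemma expressible_if [expressible_intros]:
  "expressible f \<Longrightarrow> expressible g \<Longrightarrow> expressible (\<lambda>s. if b then f s else g s)"
  by (cases b) simp_all

definition arith :: "nat \<Rightarrow> nat \<Rightarrow> nat \<Rightarrow> (nat \<Rightarrow> nat \<Rightarrow> state \<Rightarrow> real) \<Rightarrow> instr" where
  "arith t nr nc f = Arith t (mat nr nc (\<lambda>(i, j). expr (f i j)))"

lemma step_arith:
  assumes "\<And>i j. i < nr \<Longrightarrow> j < nc \<Longrightarrow> expressible (f i j)"
    and "M \<in> carrier_mat nr nc" "\<And>i j. i < nr \<Longrightarrow> j < nc \<Longrightarrow> f i j s = M $$ (i, j)"
  shows "step (arith t nr nc f) s = {s(t := M)}"
proof -
  have "map_mat (\<lambda>e. aval e s) (mat nr nc (\<lambda>(i, j). expr (f i j))) = M"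
    using assms by (intro eq_matI) (auto simp: aval_expr)
  then show ?thesis by (simp add: arith_def)
qed

fun run :: "instr list \<Rightarrow> prog \<Rightarrow> prog" where
  "run [] p = p"
| "run (c # cs) p = Seq (Instr c) (run cs p)"

lemma guarantees_Seq_det:
  "step c s = {s'} \<Longrightarrow> guarantees q s' Q \<Longrightarrow> guarantees (Seq (Instr c) q) s Q"
  by simp

lemma guarantees_If_Rank:
  "mrank (s a) = r \<Longrightarrow> guarantees p s Q \<Longrightarrow> guarantees (If_Rank a r p q) s Q"
  "mrank (s a) \<noteq> r \<Longrightarrow> guarantees q s Q \<Longrightarrow> guarantees (If_Rank a r p q) s Q"
  by simp_all

lemma guarantees_run_Cons:
  "guarantees (run (c # cs) p) s Q \<longleftrightarrow> step c s \<noteq> {} \<and> (\<forall>s'\<in>step c s. guarantees (run cs p) s' Q)"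
  by simp

lemma guarantees_run_det:
  "step c s = {s'} \<Longrightarrow> guarantees (run cs p) s' Q \<Longrightarrow> guarantees (run (c # cs) p) s Q"
  by simp

section \<open>The algorithm\<close>

definition slice_instr :: "nat \<Rightarrow> nat \<Rightarrow> nat \<Rightarrow> nat \<Rightarrow> instr" where
  "slice_instr K d a t = arith a K K (\<lambda>k c s. \<Sum>j<d. of_nat t ^ j * entry 2 (k * d + j) c s)"

text \<open>
  The computed factors are returned only if the squared distance between \<open>T\<close> and their tensor is zero. This
  makes it unnecessary to know in advance which parameters are suitable.
\<close>

definition verify :: "nat \<Rightarrow> nat \<Rightarrow> nat \<Rightarrow> prog \<Rightarrow> prog" where
  "verify I J K p =
    If_Zero (expr (\<lambda>s. \<Sum>i<I. \<Sum>j<J. \<Sum>k<K.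
        (entry 0 (i * J + j) k s - (\<Sum>c<K. entry 13 i c s * entry 12 j c s * entry 10 k c s)) ^ 2))
      (run [arith 0 I K (entry 13), arith 1 J K (entry 12)] (Instr (arith 2 K K (entry 10))))
      p"

text \<open>
  One attempt, with \<open>t\<close>, \<open>t'\<close> for the two slices and \<open>u\<close> for the weights used to factor rank-one matrices. The
  registers hold: 2 the basis \<open>N\<close>; 3 and 4 the slices; 5 their quotient; 6 and 7 its eigenvectors and
  eigenvalues; 8 the transpose of a matrix \<open>Z\<close> whose columns should be multiples of dual basis vectors; 10 the
  third factor, the inverse of register 8; 11 the slices of \<open>T\<close> at the columns of \<open>Z\<close>; 12 and 13 the second
  and the first factor. Registers 0 and 2 are preserved for the next attempt. If the slice in register 3 is
  singular, there is no quotient by it and the attempt is skipped; otherwise every instruction succeeds.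
\<close>

definition attempt :: "nat \<Rightarrow> nat \<Rightarrow> nat \<Rightarrow> nat \<Rightarrow> nat \<times> nat \<times> nat \<Rightarrow> prog \<Rightarrow> prog" where
  "attempt I J K d = (\<lambda>(t, t', u) p.
    Seq (Instr (slice_instr K d 3 t))
      (If_Rank 3 K
        (run
          [slice_instr K d 4 t',
           Solve 5 3 4,
           Eigen 6 7 5,
           arith 8 K K (\<lambda>c k s. \<Sum>r<K. entry 3 k r s * entry 6 r c s),
           arith 9 K K (\<lambda>i j s. if i = j then 1 else 0),
           Solve 10 8 9,
           arith 11 (I * J) K (\<lambda>r c s. \<Sum>k<K. entry 0 r k s * entry 8 c k s),
           arith 12 J K (\<lambda>j c s. \<Sum>i<I. of_nat u ^ i * entry 11 (i * J + j) c s),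
           arith 13 I K (\<lambda>i c s. (\<Sum>j<J. entry 11 (i * J + j) c s * entry 12 j c s) /
             (\<Sum>j<J. entry 12 j c s * entry 12 j c s))]
          (verify I J K p))
        p))"

text \<open>The final instruction is never reached, as some candidate succeeds.\<close>

fun attempts :: "nat \<Rightarrow> nat \<Rightarrow> nat \<Rightarrow> nat \<Rightarrow> (nat \<times> nat \<times> nat) list \<Rightarrow> prog" where
  "attempts I J K d [] = Instr (arith 0 0 0 (\<lambda>_ _ _. 0))"
| "attempts I J K d (x # xs) = attempt I J K d x (attempts I J K d xs)"

definition cpd_prog :: "nat \<Rightarrow> nat \<Rightarrow> nat \<Rightarrow> nat \<Rightarrow> prog" where
  "cpd_prog l I J K = (let n = 2 + l; d = K ^ Suc l; b = K * K * d + K * I in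
    run
      [arith 1 (I ^ n * J ^ n + K ^ n) (K ^ n)
         (\<lambda>r c s. sym_kernel_mat l I J K (\<lambda>i j k. entry 0 (i * J + j) k s) $$ (r, c)),
       Null_Space 2 1]
      (attempts I J K d (List.product [0..<Suc b] (List.product [0..<Suc b] [0..<Suc b]))))"

lemma expressible_sym_kernel_mat:
  assumes "r < I ^ (2 + l) * J ^ (2 + l) + K ^ (2 + l)" "c < K ^ (2 + l)"
  shows "expressible (\<lambda>s. sym_kernel_mat l I J K (\<lambda>i j k. entry 0 (i * J + j) k s) $$ (r, c))"
proof -
  have "expressible (\<lambda>s. R_mat 2 l I J K (\<lambda>i j k. entry 0 (i * J + j) k s) $$ (r, c))"
    if "r < I ^ (2 + l) * J ^ (2 + l)"
    using that assms(2) unfolding R_mat_def Let_def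
    by (simp only: index_mat prod.case det_2 mat_carrier, simp del: fact_Suc power_Suc)
      (intro expressible_intros)
  then show ?thesis
    using assms unfolding sym_kernel_mat_def Let_def
    by (simp only: index_mat prod.case, cases "r < I ^ (2 + l) * J ^ (2 + l)")
      (auto simp del: fact_Suc power_Suc intro!: expressible_intros)
qed

definition unfolding_mat :: "nat \<Rightarrow> nat \<Rightarrow> nat \<Rightarrow> tensor \<Rightarrow> real mat" where
  "unfolding_mat I J K T = mat (I * J) K (\<lambda>(r, k). T (r div J) (r mod J) k)"

lemma unfolding_mat_carrier: "unfolding_mat I J K T \<in> carrier_mat (I * J) K"
  by (simp add: unfolding_mat_def)

lemma unfolding_mat_index:
  "i < I \<Longrightarrow> j < J \<Longrightarrow> k < K \<Longrightarrow> unfolding_mat I J K T $$ (i * J + j, k) = T i j k"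
  by (simp add: unfolding_mat_def mult_add_less)

lemma entry_unfolding_mat:
  "s 0 = unfolding_mat I J K T \<Longrightarrow> i < I \<Longrightarrow> j < J \<Longrightarrow> k < K \<Longrightarrow> entry 0 (i * J + j) k s = T i j k"
  using entry_eq[of s 0 "I * J" K "i * J + j" k]
  by (simp add: unfolding_mat_carrier unfolding_mat_index mult_add_less)

lemma guarantees_verify:
  assumes s0: "s 0 = unfolding_mat I J K T"
    and car: "s 13 \<in> carrier_mat I K" "s 12 \<in> carrier_mat J K" "s 10 \<in> carrier_mat K K"
    and p: "is_pd I J K K T (s 13) (s 12) (s 10) \<or> guarantees p s Q"
    and Q: "\<And>s'. s' 0 = s 13 \<Longrightarrow> s' 1 = s 12 \<Longrightarrow> s' 2 = s 10 \<Longrightarrow> is_pd I J K K T (s 13) (s 12) (s 10) \<Longrightarrow> Q s'"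
  shows "guarantees (verify I J K p) s Q"
proof -
  let ?f = "\<lambda>s. \<Sum>i<I. \<Sum>j<J. \<Sum>k<K.
        (entry 0 (i * J + j) k s - (\<Sum>c<K. entry 13 i c s * entry 12 j c s * entry 10 k c s)) ^ 2"
  have "expressible ?f" by (intro expressible_intros)
  then have aval: "aval (expr ?f) s = ?f s" by (rule aval_expr)
  have f: "?f s = (\<Sum>i<I. \<Sum>j<J. \<Sum>k<K.
      (T i j k - (\<Sum>c<K. s 13 $$ (i, c) * s 12 $$ (j, c) * s 10 $$ (k, c))) ^ 2)"
    by (simp add: entry_unfolding_mat[where s = s, OF s0] entry_eq[where s = s, OF car(1)]
        entry_eq[where s = s, OF car(2)] entry_eq[where s = s, OF car(3)])
  have pd_iff: "?f s = 0 \<longleftrightarrow> is_pd I J K K T (s 13) (s 12) (s 10)"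
    unfolding f is_pd_def using car by (simp add: sum_nonneg_eq_0_iff sum_nonneg) auto
  show ?thesis
  proof (cases "is_pd I J K K T (s 13) (s 12) (s 10)")
    case True
    have "step (arith 0 I K (entry 13)) s = {s(0 := s 13)}"
      using car by (intro step_arith) (auto intro: expressible_intros entry_eq)
    moreover have "step (arith 1 J K (entry 12)) (s(0 := s 13)) = {s(0 := s 13, 1 := s 12)}"
      using car by (intro step_arith) (auto intro: expressible_intros simp: entry_eq[where nr = J and nc = K])
    moreover have "step (arith 2 K K (entry 10)) (s(0 := s 13, 1 := s 12)) = {s(0 := s 13, 1 := s 12, 2 := s 10)}"
      using car by (intro step_arith) (auto intro: expressible_intros simp: entry_eq[where nr = K and nc = K])
    ultimately show ?thesis
      unfolding verify_def using True pd_iff Q by (simp add: aval)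
  next
    case False
    then show ?thesis
      unfolding verify_def using p pd_iff by (simp add: aval)
  qed
qed

lemma moment_slice_dim [simp]:
  "dim_row (moment_slice d K N t) = K" "dim_col (moment_slice d K N t) = K"
  by (simp_all add: moment_slice_def)

context cpd_kernel_basis
begin

abbreviation U :: "real mat" where
  "U \<equiv> unfolding_mat I J K T"

lemma N_carrier: "N \<in> carrier_mat (K * d) K"
proof -
  have "K * d = K ^ (2 + l)" by (simp add: d)
  then show ?thesis unfolding N using mult_carrier_mat[OF X_pow_carrier carrier_simps(4)] by metis
qed

lemma step_slice_instr: "s 2 = N \<Longrightarrow> step (slice_instr K d a t) s = {s(a := N_slice t)}"
  unfolding slice_instr_def
  by (intro step_arith expressible_intros)
    (auto simp: moment_slice_def entry_eq[where a = 2 and nr = "K * d" and nc = K] N_carrier mult_add_less)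

text \<open>
  With any parameters an attempt runs to the end, whatever eigenvectors are delivered. With good ones its
  outcome passes the verification: \<open>Z * C'\<^sup>T\<close> is the identity, so contracting \<open>T\<close> with \<open>Z\<close> and expanding with \<open>C'\<close>
  restores \<open>T\<close>.
\<close>

lemma guarantees_attempt:
  assumes s0: "s 0 = U" and s2: "s 2 = N"
    and p: "good (t, t', u) \<or> (\<forall>s'. s' 0 = U \<longrightarrow> s' 2 = N \<longrightarrow> guarantees p s' (\<lambda>s. is_cpd I J K T (s 0) (s 1) (s 2)))"
  shows "guarantees (attempt I J K d (t, t', u) p) s (\<lambda>s. is_cpd I J K T (s 0) (s 1) (s 2))"
    (is "guarantees _ _ ?Q")
proof -
  let ?s1 = "s(3 := N_slice t)"
  let ?s2 = "?s1(4 := N_slice t')"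
  have step1: "step (slice_instr K d 3 t) s = {?s1}" by (rule step_slice_instr[where s = s, OF s2])
  have rank: "mrank (?s1 3) = K \<longleftrightarrow> (\<forall>r<K. moment t r \<noteq> 0)"
    using vec_space.det_rank_iff[OF carrier_simps(5), of d N t]
    by (simp add: det_moment_slice carrier_matD[OF moment_slice_carrier])
  show ?thesis
  proof (cases "\<forall>r<K. moment t r \<noteq> 0")
    case False
    then have "\<not> good (t, t', u)" by (simp add: good_def)
    then have "guarantees p ?s1 ?Q" using p s0 s2 by simp
    then show ?thesis
      unfolding attempt_def prod.case using False rank
      by (intro guarantees_Seq_det[OF step1] guarantees_If_Rank(2)) blast+
  next
    case True
    have step2: "step (slice_instr K d 4 t') ?s1 = {?s2}"
      using s2 by (intro step_slice_instr) simp
    have det: "det (N_slice t) \<noteq> 0" using True det_moment_slice by simp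
    obtain Y where Y: "Y \<in> carrier_mat K K" "N_slice t * Y = 1\<^sub>m K"
      using det_non_zero_imp_unit[OF carrier_simps(5) det, of undefined] by (auto simp: Units_def ring_mat_def)
    have solvable: "Y * N_slice t' \<in> carrier_mat K K" "N_slice t * (Y * N_slice t') = N_slice t'"
      using Y assoc_square[OF carrier_simps(5) Y(1) carrier_simps(5), of d N t d N t']
        left_mult_one_mat[OF carrier_simps(5)]
      by simp_all
    let ?\<gamma> = "pencil_eigenvalue t t'"
    \<comment> \<open>The instructions that follow the eigenvalue decomposition.\<close>
    define tail where "tail = [arith 8 K K (\<lambda>c k s. \<Sum>r<K. entry 3 k r s * entry 6 r c s),
           arith 9 K K (\<lambda>i j s. if i = j then 1 else 0),
           Solve 10 8 9,
           arith 11 (I * J) K (\<lambda>r c s. \<Sum>k<K. entry 0 r k s * entry 8 c k s),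
           arith 12 J K (\<lambda>j c s. \<Sum>i<I. of_nat u ^ i * entry 11 (i * J + j) c s),
           arith 13 I K (\<lambda>i c s. (\<Sum>j<J. entry 11 (i * J + j) c s * entry 12 j c s) /
             (\<Sum>j<J. entry 12 j c s * entry 12 j c s))]"
    have main: "guarantees (run tail (verify I J K p)) (?s2(5 := S, 6 := V, 7 := D)) ?Q"
      if S: "S \<in> carrier_mat K K" "N_slice t * S = N_slice t'" and dec: "eigen_dec S V D" for S V D
    proof -
      have V: "V \<in> carrier_mat K K" and inv: "invertible_mat V" using dec S(1) by (auto simp: eigen_dec_def)
      define Z where "Z = N_slice t * V"
      have Z: "Z \<in> carrier_mat K K" using V by (simp add: Z_def)
      have "det V \<noteq> 0"
      proof -
        obtain V' where V': "V * V' = 1\<^sub>m (dim_row V)" "V' * V = 1\<^sub>m (dim_row V')"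
          using inv unfolding invertible_mat_def inverts_mat_def by blast
        then have V'_car: "V' \<in> carrier_mat K K"
          using V by (metis carrier_matD carrier_matI index_mult_mat(2,3) index_one_mat(2,3))
        have "det V * det V' = det (V * V')"
          using det_mult[OF V V'_car] by simp
        also have "\<dots> = 1" using V'(1) V by simp
        finally show ?thesis by auto
      qed
      then have det_Z: "det (Z\<^sup>T) \<noteq> 0"
        unfolding det_transpose[OF Z] unfolding Z_def det_mult[OF carrier_simps(5) V] using det by simp
      let ?s4 = "?s2(5 := S, 6 := V, 7 := D)"
      let ?s6 = "?s4(8 := Z\<^sup>T, 9 := 1\<^sub>m K)"
      have step8: "step (tail ! 0) ?s4 = {?s4(8 := Z\<^sup>T)}"
        unfolding tail_def nth_Cons_0 using V Z
        by (intro step_arith)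
          (auto intro!: expressible_intros simp: Z_def scalar_prod_def atLeast0LessThan
            entry_eq[where nr = K and nc = K])
      have step9: "step (tail ! 1) (?s4(8 := Z\<^sup>T)) = {?s6}"
        unfolding tail_def by (simp, intro step_arith) (auto intro!: expressible_intros)
      obtain C0 where C0: "C0 \<in> carrier_mat K K" "Z\<^sup>T * C0 = 1\<^sub>m K"
        using det_non_zero_imp_unit[of "Z\<^sup>T" K undefined] Z det_Z by (auto simp: Units_def ring_mat_def)
      have rest: "guarantees (run (drop 3 tail) (verify I J K p)) (?s6(10 := C')) ?Q"
        if C': "C' \<in> carrier_mat K K" "Z\<^sup>T * C' = 1\<^sub>m K" for C'
      proof -
        define H where "H = U * Z"
        define B' where "B' = mat J K (\<lambda>(j, c). \<Sum>i<I. of_nat u ^ i * H $$ (i * J + j, c))"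
        define A' where "A' = mat I K (\<lambda>(i, c). (\<Sum>j<J. H $$ (i * J + j, c) * B' $$ (j, c)) /
             (\<Sum>j<J. B' $$ (j, c) * B' $$ (j, c)))"
        have H: "H \<in> carrier_mat (I * J) K" unfolding H_def by (rule mult_carrier_mat[OF unfolding_mat_carrier Z])
        have car: "B' \<in> carrier_mat J K" "A' \<in> carrier_mat I K" by (simp_all add: B'_def A'_def)
        let ?s7 = "?s6(10 := C')"
        have step11: "step (tail ! 3) ?s7 = {?s7(11 := H)}"
          unfolding tail_def using s0 Z H
          by (simp, intro step_arith)
            (auto intro!: expressible_intros simp: H_def scalar_prod_def atLeast0LessThan unfolding_mat_carrier
              carrier_matD[OF unfolding_mat_carrier]
              entry_eq[where a = 8 and nr = K and nc = K] entry_eq[where a = 0 and nr = "I * J" and nc = K])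
        have step12: "step (tail ! 4) (?s7(11 := H)) = {?s7(11 := H, 12 := B')}"
          unfolding tail_def using H car
          by (simp, intro step_arith)
            (auto intro!: expressible_intros simp: B'_def mult_add_less entry_eq[where nr = "I * J" and nc = K])
        have step13: "step (tail ! 5) (?s7(11 := H, 12 := B')) = {?s7(11 := H, 12 := B', 13 := A')}"
          unfolding tail_def using H car
          by (simp, intro step_arith)
            (auto intro!: expressible_intros simp: A'_def mult_add_less
              entry_eq[where a = 11 and nr = "I * J" and nc = K] entry_eq[where a = 12 and nr = J and nc = K])
        have H_slice: "H $$ (i * J + j, c) = slice (col Z c) i j" if "i < I" "j < J" "c < K" for i j c
          using that Z carrier_matD[OF unfolding_mat_carrier[of I J K T]]
          by (simp add: H_def slice_def scalar_prod_def atLeast0LessThan mult_add_less unfolding_mat_index)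
        have pd: "is_pd I J K K T A' B' C'" if g: "good (t, t', u)"
        proof -
          have AB: "A' $$ (i, c) * B' $$ (j, c) = H $$ (i * J + j, c)" if ijc: "i < I" "j < J" "c < K" for i j c
          proof -
            obtain q where q: "q < K" "\<forall>r<K. r \<noteq> q \<longrightarrow> (G * V) $$ (r, c) = 0"
              using eigenvector_single_coord[OF S(1) solution_diagonalized[OF S] dec _ ijc(3)] True g
              by (auto simp: good_def)
            obtain h where h: "\<And>i j. i < I \<Longrightarrow> j < J \<Longrightarrow> slice (col Z c) i j = h * (A $$ (i, q) * B $$ (j, q))"
              using slice_eigenvector[OF V q(2,1) ijc(3)] unfolding Z_def by blast
            show ?thesis
            proof (rule rank_one_factor[where I = I and J = J and h = h and i = i and j = j
                  and u = "\<lambda>i. of_nat u ^ i" and a = "\<lambda>i. A $$ (i, q)" and b = "\<lambda>j. B $$ (j, q)"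
                  and H = "\<lambda>i j. H $$ (i * J + j, c)" and a' = "\<lambda>i. A' $$ (i, c)" and b' = "\<lambda>j. B' $$ (j, c)"])
              show "\<exists>j<J. B $$ (j, q) \<noteq> 0"
                using rank_one_terms_nonzero[OF q(1)] by (metis mult_zero_right)
            qed (use ijc q g in \<open>simp_all add: H_slice h good_def B'_def A'_def\<close>)
          qed
          have "C' * Z\<^sup>T = 1\<^sub>m K"
            using mat_mult_left_right_inverse[of "Z\<^sup>T" K C'] Z C' by simp
          then have CZ: "(\<Sum>c<K. C' $$ (k, c) * Z $$ (k', c)) = of_bool (k = k')" if "k < K" "k' < K" for k k'
          proof -
            have "(\<Sum>c<K. C' $$ (k, c) * Z $$ (k', c)) = (C' * Z\<^sup>T) $$ (k, k')"
              using that Z C'(1) by (simp add: scalar_prod_def atLeast0LessThan)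
            then show ?thesis using that \<open>C' * Z\<^sup>T = 1\<^sub>m K\<close> by simp
          qed
          have "T i j k = (\<Sum>c<K. A' $$ (i, c) * B' $$ (j, c) * C' $$ (k, c))" if ijk: "i < I" "j < J" "k < K" for i j k
          proof -
            have "(\<Sum>c<K. A' $$ (i, c) * B' $$ (j, c) * C' $$ (k, c))
              = (\<Sum>c<K. \<Sum>k'<K. T i j k' * (C' $$ (k, c) * Z $$ (k', c)))"
            proof (rule sum.cong[OF refl])
              fix c assume "c \<in> {..<K}"
              then have c: "c < K" by simp
              have "A' $$ (i, c) * B' $$ (j, c) = (\<Sum>k'<K. T i j k' * Z $$ (k', c))"
                using AB[OF ijk(1,2) c] H_slice[OF ijk(1,2) c] Z c by (simp add: slice_def)
              then show "A' $$ (i, c) * B' $$ (j, c) * C' $$ (k, c)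
                = (\<Sum>k'<K. T i j k' * (C' $$ (k, c) * Z $$ (k', c)))"
                by (simp add: sum_distrib_left mult_ac)
            qed
            also have "\<dots> = (\<Sum>k'<K. T i j k' * of_bool (k = k'))"
              using ijk by (subst sum.swap) (simp add: sum_distrib_left[symmetric] CZ)
            also have "\<dots> = T i j k"
              using ijk by (simp add: of_bool_def if_distrib[of "\<lambda>t. _ * t"] cong: if_cong)
            finally show ?thesis by simp
          qed
          then show ?thesis using car C' by (simp add: is_pd_def)
        qed
        have "guarantees (verify I J K p) (?s7(11 := H, 12 := B', 13 := A')) ?Q"
          using s0 s2 car C' p pd
          by (intro guarantees_verify) (auto simp: is_cpd_def tensor_rank_eq)
        then show ?thesis
          using step11 step12 step13 by (simp add: tail_def numeral_eq_Suc)
      qed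
      show ?thesis
        using step8 step9 rest C0 Z by (simp add: tail_def numeral_eq_Suc) blast
    qed
    have "guarantees (run (Solve 5 3 4 # Eigen 6 7 5 # tail) (verify I J K p)) ?s2 ?Q"
      unfolding guarantees_run_Cons[of "Solve 5 3 4"]
    proof (intro conjI ballI)
      show "step (Solve 5 3 4) ?s2 \<noteq> {}"
        using solvable by auto
    next
      fix s3 assume "s3 \<in> step (Solve 5 3 4) ?s2"
      then obtain S where s3: "s3 = ?s2(5 := S)" and S: "S \<in> carrier_mat K K" "N_slice t * S = N_slice t'"
        by (auto simp: carrier_matD[OF moment_slice_carrier])
      show "guarantees (run (Eigen 6 7 5 # tail) (verify I J K p)) s3 ?Q"
        unfolding guarantees_run_Cons[of "Eigen 6 7 5"]
      proof (intro conjI ballI)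
        have "eigen_dec S F (mat_diag K ?\<gamma>)"
          using S True by (intro eigen_dec_exists solution_diagonalized) auto
        then show "step (Eigen 6 7 5) s3 \<noteq> {}"
          by (auto simp: s3)
      next
        fix s4 assume "s4 \<in> step (Eigen 6 7 5) s3"
        then obtain V D where "s4 = ?s2(5 := S, 6 := V, 7 := D)" "eigen_dec S V D"
          by (auto simp: s3)
        then show "guarantees (run tail (verify I J K p)) s4 ?Q"
          using main[OF S] by simp
      qed
    qed
    then have "guarantees (run (slice_instr K d 4 t' # Solve 5 3 4 # Eigen 6 7 5 # tail) (verify I J K p)) ?s1 ?Q"
      by (rule guarantees_run_det[OF step2])
    then show ?thesis
      unfolding attempt_def prod.case tail_def using True rank
      by (intro guarantees_Seq_det[OF step1] guarantees_If_Rank(1)) blast+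
  qed
qed

end

context cpd_kernel_basis
begin

lemma guarantees_attempts:
  assumes "s 0 = U" "s 2 = N" "\<exists>x\<in>set xs. good x"
  shows "guarantees (attempts I J K d xs) s (\<lambda>s. is_cpd I J K T (s 0) (s 1) (s 2))"
  using assms
proof (induction xs arbitrary: s)
  case Nil
  then show ?case by simp
next
  case (Cons x xs)
  obtain t t' u where x: "x = (t, t', u)" by (metis prod_cases3)
  have "good x \<or> (\<forall>s'. s' 0 = U \<longrightarrow> s' 2 = N \<longrightarrow>
      guarantees (attempts I J K d xs) s' (\<lambda>s. is_cpd I J K T (s 0) (s 1) (s 2)))"
    using Cons.prems(3) Cons.IH by auto
  then show ?case
    unfolding x attempts.simps by (rule guarantees_attempt[where s = s, OF Cons.prems(1,2)])
qed

end

context cpd_kernel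
begin

lemma step_sym_kernel_mat:
  assumes s0: "s 0 = unfolding_mat I J K T"
  shows "step (arith 1 (I ^ (2 + l) * J ^ (2 + l) + K ^ (2 + l)) (K ^ (2 + l))
      (\<lambda>r c s. sym_kernel_mat l I J K (\<lambda>i j k. entry 0 (i * J + j) k s) $$ (r, c))) s = {s(1 := sym_mat)}"
proof (rule step_arith[OF expressible_sym_kernel_mat sym_kernel_mat_carrier])
  have "R_mat 2 l I J K (\<lambda>i j k. entry 0 (i * J + j) k s) = R_mat 2 l I J K T"
    using I J K by (intro R_mat_cong) (simp_all add: entry_unfolding_mat[where s = s, OF s0])
  then show "sym_kernel_mat l I J K (\<lambda>i j k. entry 0 (i * J + j) k s) $$ (r, c) = sym_mat $$ (r, c)" for r c
    unfolding sym_kernel_mat_def by (simp only:)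
qed

lemma guarantees_cpd_prog:
  "guarantees (cpd_prog l I J K) (input_state I J K T) (\<lambda>s. is_cpd I J K T (s 0) (s 1) (s 2))"
proof -
  let ?Q = "\<lambda>s. is_cpd I J K T (s 0) (s 1) (s 2)"
  define d where "d = K ^ Suc l"
  define b where "b = K * K * d + K * I"
  let ?cands = "List.product [0..<Suc b] (List.product [0..<Suc b] [0..<Suc b])"
  let ?s0 = "input_state I J K T"
  have s0: "?s0 0 = unfolding_mat I J K T"
    by (simp add: input_state_def unfolding_mat_def)
  have "guarantees (run [Null_Space 2 1] (attempts I J K d ?cands)) (?s0(1 := sym_mat)) ?Q"
    unfolding guarantees_run_Cons run.simps(1)
  proof (intro conjI ballI)
    show "step (Null_Space 2 1) (?s0(1 := sym_mat)) \<noteq> {}"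
      using basis_mat_kernel_exists[OF sym_kernel_mat_carrier]
      by (auto simp: carrier_matD[OF sym_kernel_mat_carrier])
  next
    fix s assume "s \<in> step (Null_Space 2 1) (?s0(1 := sym_mat))"
    then obtain N where N: "basis_mat (K ^ (2 + l)) (mat_kernel sym_mat) N" and s: "s = ?s0(1 := sym_mat, 2 := N)"
      unfolding step.simps by (auto simp only: carrier_matD[OF sym_kernel_mat_carrier] fun_upd_same mem_Collect_eq)
    obtain F G where FG: "F \<in> carrier_mat K K" "G \<in> carrier_mat K K"
      "F * G = 1\<^sub>m K" "G * F = 1\<^sub>m K" "N = X_pow (2 + l) * G"
      by (rule kernel_basis_factor[OF refl N])
    interpret cpd_kernel_basis I J K l T A B C d N F G
      using FG by unfold_locales (simp_all add: d_def)
    obtain t t' u where "t \<le> b" "t' \<le> b" "u \<le> b" and good: "good (t, t', u)"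
      using good_exists[of b] by (auto simp: b_def)
    then have "(t, t', u) \<in> set ?cands"
      by (simp add: less_Suc_eq_le del: upt_Suc)
    with good have "\<exists>x\<in>set ?cands. good x" ..
    then show "guarantees (attempts I J K d ?cands) s ?Q"
      using s0 by (intro guarantees_attempts) (simp_all add: s)
  qed
  then show ?thesis
    unfolding cpd_prog_def Let_def d_def b_def
    by (rule guarantees_run_det[OF step_sym_kernel_mat[where s = ?s0, OF s0]])
qed

end

theorem theorem8:
  fixes I J K R l :: nat
  assumes "I \<ge> 1" and "J \<ge> 1" and "K = R" and "R \<ge> 2"
  shows
    "(\<forall>A B C T.
        is_pd I J K R T A B C \<and> mrank C = R \<and>
        subsp_dim (K ^ (2 + l)) (mat_kernel (R_mat 2 l I J K T) \<inter> sym_space (2 + l) K) = R \<longrightarrow>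
        tensor_rank I J K T = R \<and> cpd_unique I J K T)
     \<and>
     cpd_found_algebraically I J K
       {T. \<exists>A B C.
          is_pd I J K R T A B C \<and> mrank C = R \<and>
          subsp_dim (K ^ (2 + l)) (mat_kernel (R_mat 2 l I J K T) \<inter> sym_space (2 + l) K) = R}"
proof -
  have kernel: "cpd_kernel I J K l T A B C"
    if "is_pd I J K R T A B C \<and> mrank C = R \<and>
      subsp_dim (K ^ (2 + l)) (mat_kernel (R_mat 2 l I J K T) \<inter> sym_space (2 + l) K) = R"
    for A B C T
  proof -
    have "C \<in> carrier_mat R R" using that assms(3) by (simp add: is_pd_def)
    then have "det C \<noteq> 0" using that vec_space.det_rank_iff[of C R] by simp
    then show ?thesis
      using that assms by unfold_locales simp_all
  qed
  show ?thesis
  proof (intro conjI allI impI)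
    fix A B C T
    assume "is_pd I J K R T A B C \<and> mrank C = R \<and>
      subsp_dim (K ^ (2 + l)) (mat_kernel (R_mat 2 l I J K T) \<inter> sym_space (2 + l) K) = R"
    note ker = kernel[OF this]
    show "tensor_rank I J K T = R"
      using cpd_kernel.tensor_rank_eq[OF ker] assms(3) by simp
    show "cpd_unique I J K T"
      by (rule cpd_unique_if_kernel_dim[OF ker])
  next
    show "cpd_found_algebraically I J K
       {T. \<exists>A B C.
          is_pd I J K R T A B C \<and> mrank C = R \<and>
          subsp_dim (K ^ (2 + l)) (mat_kernel (R_mat 2 l I J K T) \<inter> sym_space (2 + l) K) = R}"
      unfolding cpd_found_algebraically_def
      using cpd_kernel.guarantees_cpd_prog[OF kernel] by blast
  qed
qed

end
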